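(* Let $(L,\gamma,\Delta_\cdot,\alpha)$ be a comultiplicative post-Hom-Lie coalgebra and let $k\ge0$ be an integer. Define $\Delta_\circ,\Delta_\ast:L\to L\otimes L$ by $$\Delta_\circ=(\alpha^k\otimes I)\circ\gamma,\qquad \Delta_\ast=(\alpha^k\otimes I)\circ\Delta_\cdot .$$ Then $(L,\Delta_\circ,\Delta_\ast,\alpha)$ is a comodule over the post-Hom-Lie coalgebra $(L,\gamma,\Delta_\cdot,\alpha)$ (with $M=L$, $\Delta_\diamond=\Delta_\circ$, $\Delta_\bullet=\Delta_\ast$, $\alpha_M=\alpha$).
   Context: All vector spaces are over a field $\mathbb{F}$ of characteristic $0$; $I$ is the identity map, $\tau(x\otimes y)=y\otimes x$, $\xi(x\otimes y\otimes z)=y\otimes z\otimes x$, $\xi^2(x\otimes y\otimes z)=z\otimes x\otimes y$. A post-Hom-Lie coalgebra $(L,\gamma,\Delta_\cdot,\alpha)$ is a vector space $L$ with linear maps $\gamma,\Delta_\cdot:L\to L\otimes L$ and $\alpha:L\to L$ such that (i) $\gamma=-\tau\circ\gamma$ and $\gamma\circ\alpha=(\alpha\otimes\alpha)\circ\gamma$; (ii) $(1+\xi+\xi^2)\circ(\alpha\otimes\gamma)\circ\gamma=0$; (iii) $(\alpha\otimes\gamma)\circ\Delta_\cdot-(\Delta_\cdot\otimes\alpha)\circ\gamma-(\tau\otimes I)\circ(\alpha\otimes\Delta_\cdot)\circ\gamma=0$; (iv) $(\Delta_\cdot\otimes\alpha)\circ\Delta_\cdot-(\alpha\otimes\Delta_\cdot)\circ\Delta_\cdot-(\tau\otimes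 I)\circ(\Delta_\cdot\otimes\alpha)\circ\Delta_\cdot+(\tau\otimes I)\circ(\alpha\otimes\Delta_\cdot)\circ\Delta_\cdot+(\gamma\otimes\alpha)\circ\Delta_\cdot=0$. It is comultiplicative if moreover $\Delta_\cdot\circ\alpha=(\alpha\otimes\alpha)\circ\Delta_\cdot$. A comodule over $L$ is a tuple $(M,\Delta_\diamond,\Delta_\bullet,\alpha_M)$ with $M$ a vector space, $\alpha_M:M\to M$ linear, and linear maps $\Delta_\diamond,\Delta_\bullet:M\to L\otimes M$ such that (a) $\Delta_\diamond\circ\alpha_M=(\alpha\otimes\alpha_M)\circ\Delta_\diamond$ and $\Delta_\bullet\circ\alpha_M=(\alpha\otimes\alpha_M)\circ\Delta_\bullet$; (b) $(\gamma\otimes\alpha_M)\circ\Delta_\diamond=(\alpha\otimes\Delta_\diamond)\circ\Delta_\diamond-(\tau\otimes \mathrm{Id}_M)\circ(\alpha\otimes\Delta_\diamond)\circ\Delta_\diamond$; (c) $(\Delta_\cdot\otimes\alpha_M)\circ\Delta_\diamond=(\alpha\otimes\Delta_\diamond)\circ\Delta_\bullet-(\tau\otimes \mathrm{Id}_M)\circ(\alpha\otimes\Delta_\bullet)\circ\Delta_\diamond$; (d) $(\gamma\otimes\alpha_M)\circ\Delta_\bullet=(1-\tau\otimes \mathrm{Id}_M)\circ(\alpha\otimes\Delta_\bullet)\circ\Delta_\bullet+(\tau\otimes \mathrm{Id}_M-1)\circ(\Delta_\cdot\otimes\alpha_M)\circ\Delta_\bullet$. *)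

theory Defs
  imports "HOL-Algebra.Module" "HOL-Algebra.AbelCoset"
begin

section \<open>Linear and bilinear maps\<close>

definition linear_maps ::
  "('r, 'x) ring_scheme \<Rightarrow> ('r, 'm, 'y) module_scheme \<Rightarrow> ('r, 'n, 'z) module_scheme \<Rightarrow> ('m \<Rightarrow> 'n) set"
  where "linear_maps R M N =
    {f \<in> carrier M \<rightarrow> carrier N.
      (\<forall>x\<in>carrier M. \<forall>y\<in>carrier M. f (x \<oplus>\<^bsub>M\<^esub> y) = f x \<oplus>\<^bsub>N\<^esub> f y) \<and>
      (\<forall>a\<in>carrier R. \<forall>x\<in>carrier M. f (a \<odot>\<^bsub>M\<^esub> x) = a \<odot>\<^bsub>N\<^esub> f x)}"

definition bilinear_maps ::
  "('r, 'x) ring_scheme \<Rightarrow> ('r, 'm, 'y) module_scheme \<Rightarrow> ('r, 'n, 'z) module_scheme \<Rightarrow>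
    ('r, 'p, 'w) module_scheme \<Rightarrow> ('m \<Rightarrow> 'n \<Rightarrow> 'p) set"
  where "bilinear_maps R M N P =
    {b. (\<forall>x\<in>carrier M. b x \<in> linear_maps R N P) \<and>
        (\<forall>y\<in>carrier N. (\<lambda>x. b x y) \<in> linear_maps R M P)}"


section \<open>The tensor product\<close>

text \<open>
  The tensor product of \<open>M\<close> and \<open>N\<close> is the free module on \<open>carrier M \<times> carrier N\<close> modulo the
  submodule generated by the bilinearity relations. The fields \<open>mult\<close> and \<open>one\<close>, which the
  record type \<open>module\<close> inherits from \<open>ring\<close>, play no role for modules and are left undefined.
\<close>

definition free_module :: "('r, 'x) ring_scheme \<Rightarrow> 'i set \<Rightarrow> ('r, 'i \<Rightarrow> 'r) module"
  where "free_module R I =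
    \<lparr>carrier = {f. range f \<subseteq> carrier R \<and> finite {i. f i \<noteq> \<zero>\<^bsub>R\<^esub>} \<and> {i. f i \<noteq> \<zero>\<^bsub>R\<^esub>} \<subseteq> I},
     mult = undefined, one = undefined,
     zero = (\<lambda>_. \<zero>\<^bsub>R\<^esub>), add = (\<lambda>f g i. f i \<oplus>\<^bsub>R\<^esub> g i),
     smult = (\<lambda>a f i. a \<otimes>\<^bsub>R\<^esub> f i)\<rparr>"

definition free_gen :: "('r, 'x) ring_scheme \<Rightarrow> 'i \<Rightarrow> 'i \<Rightarrow> 'r"
  where "free_gen R i = (\<lambda>j. if j = i then \<one>\<^bsub>R\<^esub> else \<zero>\<^bsub>R\<^esub>)"

definition submodule_hull :: "('r, 'x) ring_scheme \<Rightarrow> ('r, 'm, 'y) module_scheme \<Rightarrow> 'm set \<Rightarrow> 'm set"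
  where "submodule_hull R M S = \<Inter>{H. submodule H R M \<and> S \<subseteq> H}"

definition quotient_module ::
  "('r, 'm, 'y) module_scheme \<Rightarrow> 'm set \<Rightarrow> ('r, 'm set) module"
  where "quotient_module M H =
    \<lparr>carrier = a_rcosets\<^bsub>M\<^esub> H, mult = undefined, one = undefined,
     zero = H, add = (\<lambda>X Y. X <+>\<^bsub>M\<^esub> Y),
     smult = (\<lambda>a X. \<Union>x\<in>X. H +>\<^bsub>M\<^esub> (a \<odot>\<^bsub>M\<^esub> x))\<rparr>"

definition tensor_relations ::
  "('r, 'x) ring_scheme \<Rightarrow> ('r, 'm, 'y) module_scheme \<Rightarrow> ('r, 'n, 'z) module_scheme \<Rightarrow>
    ('m \<times> 'n \<Rightarrow> 'r) set"
  where "tensor_relations R M N =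
    (let F = free_module R (carrier M \<times> carrier N); e = (\<lambda>x y. free_gen R (x, y)) in
      {e (x \<oplus>\<^bsub>M\<^esub> x') y \<ominus>\<^bsub>F\<^esub> (e x y \<oplus>\<^bsub>F\<^esub> e x' y) | x x' y.
        x \<in> carrier M \<and> x' \<in> carrier M \<and> y \<in> carrier N} \<union>
      {e x (y \<oplus>\<^bsub>N\<^esub> y') \<ominus>\<^bsub>F\<^esub> (e x y \<oplus>\<^bsub>F\<^esub> e x y') | x y y'.
        x \<in> carrier M \<and> y \<in> carrier N \<and> y' \<in> carrier N} \<union>
      {e (a \<odot>\<^bsub>M\<^esub> x) y \<ominus>\<^bsub>F\<^esub> a \<odot>\<^bsub>F\<^esub> e x y | a x y.
        a \<in> carrier R \<and> x \<in> carrier M \<and> y \<in> carrier N} \<union>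
      {e x (a \<odot>\<^bsub>N\<^esub> y) \<ominus>\<^bsub>F\<^esub> a \<odot>\<^bsub>F\<^esub> e x y | a x y.
        a \<in> carrier R \<and> x \<in> carrier M \<and> y \<in> carrier N})"

definition tensor_null ::
  "('r, 'x) ring_scheme \<Rightarrow> ('r, 'm, 'y) module_scheme \<Rightarrow> ('r, 'n, 'z) module_scheme \<Rightarrow>
    ('m \<times> 'n \<Rightarrow> 'r) set"
  where "tensor_null R M N =
    submodule_hull R (free_module R (carrier M \<times> carrier N)) (tensor_relations R M N)"

definition tensor_prod ::
  "('r, 'x) ring_scheme \<Rightarrow> ('r, 'm, 'y) module_scheme \<Rightarrow> ('r, 'n, 'z) module_scheme \<Rightarrow>
    ('r, ('m \<times> 'n \<Rightarrow> 'r) set) module"  (infixr \<open>\<otimes>\<otimes>\<index>\<close> 75)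
  where "M \<otimes>\<otimes>\<^bsub>R\<^esub> N = quotient_module (free_module R (carrier M \<times> carrier N)) (tensor_null R M N)"

definition tensor_elem ::
  "('r, 'x) ring_scheme \<Rightarrow> ('r, 'm, 'y) module_scheme \<Rightarrow> ('r, 'n, 'z) module_scheme \<Rightarrow>
    'm \<Rightarrow> 'n \<Rightarrow> ('m \<times> 'n \<Rightarrow> 'r) set"
  where "tensor_elem R M N x y =
    tensor_null R M N +>\<^bsub>free_module R (carrier M \<times> carrier N)\<^esub> free_gen R (x, y)"

text \<open>
  The linear map out of \<open>M \<otimes>\<otimes>\<^bsub>R\<^esub> N\<close> induced by a bilinear map \<open>b\<close>. Requiring the map to be
  extensional makes it unique as a HOL function; existence and uniqueness are proved in
  \<open>tensor_universal\<close> below.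
\<close>

definition tensor_lift ::
  "('r, 'x) ring_scheme \<Rightarrow> ('r, 'm, 'y) module_scheme \<Rightarrow> ('r, 'n, 'z) module_scheme \<Rightarrow>
    ('r, 'p, 'w) module_scheme \<Rightarrow> ('m \<Rightarrow> 'n \<Rightarrow> 'p) \<Rightarrow> ('m \<times> 'n \<Rightarrow> 'r) set \<Rightarrow> 'p"
  where "tensor_lift R M N P b =
    (THE h. h \<in> linear_maps R (M \<otimes>\<otimes>\<^bsub>R\<^esub> N) P \<and> h \<in> extensional (carrier (M \<otimes>\<otimes>\<^bsub>R\<^esub> N)) \<and>
      (\<forall>x\<in>carrier M. \<forall>y\<in>carrier N. h (tensor_elem R M N x y) = b x y))"

text \<open>\<open>f \<otimes> g : M \<otimes> N \<rightarrow> M' \<otimes> N'\<close> for \<open>f : M \<rightarrow> M'\<close> and \<open>g : N \<rightarrow> N'\<close>.\<close>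

definition tensor_map ::
  "('r, 'x) ring_scheme \<Rightarrow> ('r, 'm, 'y) module_scheme \<Rightarrow> ('r, 'n, 'z) module_scheme \<Rightarrow>
    ('r, 'm1, 'y1) module_scheme \<Rightarrow> ('r, 'n1, 'z1) module_scheme \<Rightarrow>
    ('m \<Rightarrow> 'm1) \<Rightarrow> ('n \<Rightarrow> 'n1) \<Rightarrow> ('m \<times> 'n \<Rightarrow> 'r) set \<Rightarrow> ('m1 \<times> 'n1 \<Rightarrow> 'r) set"
  where "tensor_map R M N M' N' f g =
    tensor_lift R M N (M' \<otimes>\<otimes>\<^bsub>R\<^esub> N') (\<lambda>x y. tensor_elem R M' N' (f x) (g y))"

definition tensor_swap ::
  "('r, 'x) ring_scheme \<Rightarrow> ('r, 'm, 'y) module_scheme \<Rightarrow> ('r, 'n, 'z) module_scheme \<Rightarrow>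
    ('m \<times> 'n \<Rightarrow> 'r) set \<Rightarrow> ('n \<times> 'm \<Rightarrow> 'r) set"
  where "tensor_swap R M N =
    tensor_lift R M N (N \<otimes>\<otimes>\<^bsub>R\<^esub> M) (\<lambda>x y. tensor_elem R N M y x)"

abbreviation tensor_elem3 ::
  "('r, 'x) ring_scheme \<Rightarrow> ('r, 'm, 'y) module_scheme \<Rightarrow> ('r, 'n, 'z) module_scheme \<Rightarrow>
    ('r, 'p, 'w) module_scheme \<Rightarrow> 'm \<Rightarrow> 'n \<Rightarrow> 'p \<Rightarrow> (('m \<times> 'n \<Rightarrow> 'r) set \<times> 'p \<Rightarrow> 'r) set"
  where "tensor_elem3 R M N P x y z \<equiv> tensor_elem R (M \<otimes>\<otimes>\<^bsub>R\<^esub> N) P (tensor_elem R M N x y) z"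

text \<open>
  Triple tensor products are identified with the left-bracketed \<open>(M \<otimes> N) \<otimes> P\<close>. Maps that land
  in \<open>M \<otimes> (N \<otimes> P)\<close>, such as \<open>(\<alpha> \<otimes> \<gamma>) \<circ> \<gamma>\<close>, are followed by the canonical isomorphism
  \<open>x \<otimes> (y \<otimes> z) \<mapsto> (x \<otimes> y) \<otimes> z\<close>.
\<close>

definition tensor_assoc ::
  "('r, 'x) ring_scheme \<Rightarrow> ('r, 'm, 'y) module_scheme \<Rightarrow> ('r, 'n, 'z) module_scheme \<Rightarrow>
    ('r, 'p, 'w) module_scheme \<Rightarrow>
    ('m \<times> ('n \<times> 'p \<Rightarrow> 'r) set \<Rightarrow> 'r) set \<Rightarrow> (('m \<times> 'n \<Rightarrow> 'r) set \<times> 'p \<Rightarrow> 'r) set"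
  where "tensor_assoc R M N P =
    tensor_lift R M (N \<otimes>\<otimes>\<^bsub>R\<^esub> P) ((M \<otimes>\<otimes>\<^bsub>R\<^esub> N) \<otimes>\<otimes>\<^bsub>R\<^esub> P)
      (\<lambda>x. tensor_lift R N P ((M \<otimes>\<otimes>\<^bsub>R\<^esub> N) \<otimes>\<otimes>\<^bsub>R\<^esub> P) (\<lambda>y z. tensor_elem3 R M N P x y z))"

text \<open>The map \<open>\<xi>\<close>, i.e. \<open>x \<otimes> y \<otimes> z \<mapsto> y \<otimes> z \<otimes> x\<close>; see the lemma \<open>tensor_cycle\<close> below.\<close>

definition tensor_cycle ::
  "('r, 'x) ring_scheme \<Rightarrow> ('r, 'm, 'y) module_scheme \<Rightarrow>
    (('m \<times> 'm \<Rightarrow> 'r) set \<times> 'm \<Rightarrow> 'r) set \<Rightarrow> (('m \<times> 'm \<Rightarrow> 'r) set \<times> 'm \<Rightarrow> 'r) set"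
  where "tensor_cycle R L =
    tensor_lift R (L \<otimes>\<otimes>\<^bsub>R\<^esub> L) L ((L \<otimes>\<otimes>\<^bsub>R\<^esub> L) \<otimes>\<otimes>\<^bsub>R\<^esub> L)
      (\<lambda>t z. tensor_lift R L L ((L \<otimes>\<otimes>\<^bsub>R\<^esub> L) \<otimes>\<otimes>\<^bsub>R\<^esub> L) (\<lambda>x y. tensor_elem3 R L L L y z x) t)"


subsection \<open>The universal property\<close>

lemma (in abelian_group) minus_eq_zero_iff:
  "x \<in> carrier G \<Longrightarrow> y \<in> carrier G \<Longrightarrow> x \<ominus> y = \<zero> \<longleftrightarrow> x = y"
  by (metis a_inv_closed a_minus_def minus_equality minus_minus r_neg)

lemma submodule_hull_superset: "S \<subseteq> submodule_hull R M S"
  by (auto simp: submodule_hull_def)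

lemma submodule_hull_least: "submodule H R M \<Longrightarrow> S \<subseteq> H \<Longrightarrow> submodule_hull R M S \<subseteq> H"
  by (auto simp: submodule_hull_def)

lemma (in module) submodule_submodule_hull:
  assumes "S \<subseteq> carrier M"
  shows "submodule (submodule_hull R M S) R M"
proof (rule submoduleI)
  show "submodule_hull R M S \<subseteq> carrier M"
    using submodule_hull_least[OF carrier_is_submodule assms] .
  show "\<zero>\<^bsub>M\<^esub> \<in> submodule_hull R M S"
    unfolding submodule_hull_def
    using subgroup.one_closed submodule.axioms(1) by fastforce
qed (auto simp: submodule_hull_def dest: submoduleE)

lemma module_free_module:
  fixes R :: "('r, 'x) ring_scheme" and I :: "'i set"
  assumes "cring R"
  shows "module R (free_module R I)"
proof -
  interpret cring R by fact
  have sub: "finite {i. f i \<noteq> \<zero>\<^bsub>R\<^esub>} \<Longrightarrow> finite {i. g i \<noteq> \<zero>\<^bsub>R\<^esub>} \<Longrightarrow> finite {i. f i \<oplus>\<^bsub>R\<^esub> g i \<noteq> \<zero>\<^bsub>R\<^esub>}" for f g :: "'i \<Rightarrow> 'r"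
    by (rule finite_subset[of _ "{i. f i \<noteq> \<zero>\<^bsub>R\<^esub>} \<union> {i. g i \<noteq> \<zero>\<^bsub>R\<^esub>}"]) auto
  have sm: "finite {i. f i \<noteq> \<zero>\<^bsub>R\<^esub>} \<Longrightarrow> a \<in> carrier R \<Longrightarrow> finite {i. a \<otimes>\<^bsub>R\<^esub> f i \<noteq> \<zero>\<^bsub>R\<^esub>}" for f :: "'i \<Rightarrow> 'r" and a
    by (rule finite_subset[of _ "{i. f i \<noteq> \<zero>\<^bsub>R\<^esub>}"]) auto
  have ng: "finite {i. f i \<noteq> \<zero>\<^bsub>R\<^esub>} \<Longrightarrow> range f \<subseteq> carrier R \<Longrightarrow> finite {i. \<ominus>\<^bsub>R\<^esub> f i \<noteq> \<zero>\<^bsub>R\<^esub>}" for f :: "'i \<Rightarrow> 'r"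
    by (rule finite_subset[of _ "{i. f i \<noteq> \<zero>\<^bsub>R\<^esub>}"]) auto
  show ?thesis
  proof (rule moduleI)
    show "abelian_group (free_module R I)"
    proof (rule abelian_groupI)
      fix x y assume "x \<in> carrier (free_module R I)" "y \<in> carrier (free_module R I)"
      then have r: "\<And>i. x i \<in> carrier R" "\<And>i. y i \<in> carrier R" 
        and s: "{i. x i \<noteq> \<zero>\<^bsub>R\<^esub>} \<subseteq> I" "{i. y i \<noteq> \<zero>\<^bsub>R\<^esub>} \<subseteq> I" 
        and f: "finite {i. x i \<noteq> \<zero>\<^bsub>R\<^esub>}" "finite {i. y i \<noteq> \<zero>\<^bsub>R\<^esub>}" 
        by (auto simp: free_module_def)
      have "{i. x i \<oplus>\<^bsub>R\<^esub> y i \<noteq> \<zero>\<^bsub>R\<^esub>} \<subseteq> I" using s by force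
      with r sub[OF f] show "x \<oplus>\<^bsub>free_module R I\<^esub> y \<in> carrier (free_module R I)"
        by (auto simp: free_module_def)
    next
      fix x assume "x \<in> carrier (free_module R I)"
      then have r: "\<And>i. x i \<in> carrier R" 
        and s: "{i. x i \<noteq> \<zero>\<^bsub>R\<^esub>} \<subseteq> I"
        and f: "finite {i. x i \<noteq> \<zero>\<^bsub>R\<^esub>}" 
        by (auto simp: free_module_def)
      let ?y = "\<lambda>i. \<ominus>\<^bsub>R\<^esub> x i"
      have "finite {i. ?y i \<noteq> \<zero>\<^bsub>R\<^esub>}" using ng[OF f] r by auto
      moreover have "{i. ?y i \<noteq> \<zero>\<^bsub>R\<^esub>} \<subseteq> I" using s by force
      ultimately have "?y \<in> carrier (free_module R I)" using r by (auto simp: free_module_def)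
      moreover have "?y \<oplus>\<^bsub>free_module R I\<^esub> x = \<zero>\<^bsub>free_module R I\<^esub>"
        using r by (auto simp: free_module_def l_neg)
      ultimately show "\<exists>y\<in>carrier (free_module R I). y \<oplus>\<^bsub>free_module R I\<^esub> x = \<zero>\<^bsub>free_module R I\<^esub>" by blast
    qed (auto simp: free_module_def a_ac image_subset_iff)
  next
    fix a x assume a: "a \<in> carrier R" and x: "x \<in> carrier (free_module R I)"
    have "{i. a \<otimes>\<^bsub>R\<^esub> x i \<noteq> \<zero>\<^bsub>R\<^esub>} \<subseteq> I" using a x by (force simp: free_module_def)
    then show "a \<odot>\<^bsub>free_module R I\<^esub> x \<in> carrier (free_module R I)"
      using a x sm[of x a] by (auto simp: free_module_def)
  qed (auto simp: assms free_module_def image_subset_iff l_distr r_distr m_assoc)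
qed

lemma (in cring) free_gen_closed: "i \<in> I \<Longrightarrow> free_gen R i \<in> carrier (free_module R I)"
  by (auto simp: free_gen_def free_module_def)

lemma (in cring) free_module_induct:
  assumes f: "f \<in> carrier (free_module R I)"
    and H: "submodule H R (free_module R I)" and gen: "\<And>i. i \<in> I \<Longrightarrow> free_gen R i \<in> H"
  shows "f \<in> H"
proof -
  interpret F: module R "free_module R I" by (rule module_free_module) (rule is_cring)
  have "finite A \<Longrightarrow> f \<in> carrier (free_module R I) \<Longrightarrow> {i. f i \<noteq> \<zero>} \<subseteq> A \<Longrightarrow> f \<in> H" for A f
  proof (induction A arbitrary: f rule: finite_induct)
    case empty
    then have "f = \<zero>\<^bsub>free_module R I\<^esub>" by (auto simp: free_module_def)
    then show ?case using subgroup.one_closed[OF submodule.axioms(1)[OF H]] by simp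
  next
    case (insert j A)
    have fr: "\<And>i. f i \<in> carrier R" and ff: "finite {i. f i \<noteq> \<zero>}" and fI: "{i. f i \<noteq> \<zero>} \<subseteq> I"
      using insert.prems(1) by (auto simp: free_module_def)
    show ?case
    proof (cases "f j = \<zero>")
      case True
      then show ?thesis using insert.prems insert.IH by blast
    next
      case False
      then have j: "j \<in> I" using fI by auto
      define g where "g = f(j := \<zero>)"
      have "{i. g i \<noteq> \<zero>} \<subseteq> {i. f i \<noteq> \<zero>}" by (auto simp: g_def)
      then have gc: "g \<in> carrier (free_module R I)"
        using fr fI finite_subset[OF _ ff, of "{i. g i \<noteq> \<zero>}"] by (auto simp: free_module_def g_def)
      moreover have "{i. g i \<noteq> \<zero>} \<subseteq> A" using insert.prems(2) by (auto simp: g_def)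
      ultimately have "g \<in> H" by (rule insert.IH)
      moreover have "f j \<odot>\<^bsub>free_module R I\<^esub> free_gen R j \<in> H"
        using F.submoduleE(4)[OF H] gen[OF j] fr by blast
      moreover have "f = g \<oplus>\<^bsub>free_module R I\<^esub> (f j \<odot>\<^bsub>free_module R I\<^esub> free_gen R j)"
        using fr by (auto simp: free_module_def free_gen_def g_def)
      ultimately show ?thesis using F.submoduleE(5)[OF H] by metis
    qed
  qed
  moreover have "finite {i. f i \<noteq> \<zero>}" using f by (simp add: free_module_def)
  ultimately show ?thesis using f by blast
qed

lemma linear_mapsD:
  assumes "f \<in> linear_maps R M N"
  shows "x \<in> carrier M \<Longrightarrow> f x \<in> carrier N"
    and "x \<in> carrier M \<Longrightarrow> y \<in> carrier M \<Longrightarrow> f (x \<oplus>\<^bsub>M\<^esub> y) = f x \<oplus>\<^bsub>N\<^esub> f y"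
    and "a \<in> carrier R \<Longrightarrow> x \<in> carrier M \<Longrightarrow> f (a \<odot>\<^bsub>M\<^esub> x) = a \<odot>\<^bsub>N\<^esub> f x"
  using assms by (auto simp: linear_maps_def)

lemma linear_maps_zero_minus:
  assumes "module R M" "module R N" "f \<in> linear_maps R M N"
  shows "f \<zero>\<^bsub>M\<^esub> = \<zero>\<^bsub>N\<^esub>"
    and "x \<in> carrier M \<Longrightarrow> f (\<ominus>\<^bsub>M\<^esub> x) = \<ominus>\<^bsub>N\<^esub> f x"
    and "x \<in> carrier M \<Longrightarrow> y \<in> carrier M \<Longrightarrow> f (x \<ominus>\<^bsub>M\<^esub> y) = f x \<ominus>\<^bsub>N\<^esub> f y"
proof -
  interpret M: module R M by fact
  interpret N: module R N by fact
  note l = linear_mapsD[OF assms(3)]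
  show z: "f \<zero>\<^bsub>M\<^esub> = \<zero>\<^bsub>N\<^esub>"
    using l(3)[of "\<zero>\<^bsub>R\<^esub>" "\<zero>\<^bsub>M\<^esub>"] l(1)[of "\<zero>\<^bsub>M\<^esub>"] by simp
  show m: "f (\<ominus>\<^bsub>M\<^esub> x) = \<ominus>\<^bsub>N\<^esub> f x" if "x \<in> carrier M" for x
  proof -
    have "f x \<oplus>\<^bsub>N\<^esub> f (\<ominus>\<^bsub>M\<^esub> x) = \<zero>\<^bsub>N\<^esub>"
      using l(2)[of x "\<ominus>\<^bsub>M\<^esub> x"] z that by (simp add: M.r_neg)
    then show ?thesis using l(1) that by (metis M.a_inv_closed N.a_comm N.minus_equality)
  qed
  show "f (x \<ominus>\<^bsub>M\<^esub> y) = f x \<ominus>\<^bsub>N\<^esub> f y" if "x \<in> carrier M" "y \<in> carrier M"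
    using that l(2)[of x "\<ominus>\<^bsub>M\<^esub> y"] m[of y] by (simp add: a_minus_def)
qed

lemma submodule_equalizer:
  assumes M: "module R M" and N: "module R N"
    and f: "f \<in> linear_maps R M N" and g: "g \<in> linear_maps R M N"
  shows "submodule {x \<in> carrier M. f x = g x} R M"
proof -
  interpret M: module R M by fact
  interpret N: module R N by fact
  show ?thesis
    by (rule M.submoduleI)
      (auto simp: linear_mapsD[OF f] linear_mapsD[OF g] linear_maps_zero_minus[OF M N f]
        linear_maps_zero_minus[OF M N g])
qed

lemma free_module_extend:
  assumes M: "module R P" and p: "\<And>i. i \<in> I \<Longrightarrow> p i \<in> carrier P"
  shows "\<exists>h \<in> linear_maps R (free_module R I) P. \<forall>i\<in>I. h (free_gen R i) = p i"
proof -
  interpret P: module R P by fact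
  let ?F = "free_module R I"
  define h where "h = (\<lambda>f. \<Oplus>\<^bsub>P\<^esub>i\<in>{i. f i \<noteq> \<zero>\<^bsub>R\<^esub>}. f i \<odot>\<^bsub>P\<^esub> p i)"
  have h_eq: "h f = (\<Oplus>\<^bsub>P\<^esub>i\<in>A. f i \<odot>\<^bsub>P\<^esub> p i)"
    if "f \<in> carrier ?F" "finite A" "A \<subseteq> I" "{i. f i \<noteq> \<zero>\<^bsub>R\<^esub>} \<subseteq> A" for f A
    unfolding h_def
    by (rule P.add.finprod_mono_neutral_cong_left) (use that p in \<open>auto simp: free_module_def subset_iff\<close>)
  have "h \<in> linear_maps R ?F P"
    unfolding linear_maps_def
  proof (intro CollectI conjI ballI funcsetI)
    fix f assume "f \<in> carrier ?F"
    then show "h f \<in> carrier P"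
      unfolding h_def by (intro P.finsum_closed) (auto simp: free_module_def subset_iff p)
  next
    fix f g assume f: "f \<in> carrier ?F" and g: "g \<in> carrier ?F"
    interpret F: module R ?F by (rule module_free_module) (rule P.R.is_cring)
    let ?A = "{i. f i \<noteq> \<zero>\<^bsub>R\<^esub>} \<union> {i. g i \<noteq> \<zero>\<^bsub>R\<^esub>}"
    have A: "finite ?A" "?A \<subseteq> I" using f g by (auto simp: free_module_def)
    have r: "f i \<in> carrier R" "g i \<in> carrier R" for i using f g by (auto simp: free_module_def)
    have pA: "i \<in> ?A \<Longrightarrow> p i \<in> carrier P" for i using A(2) p by auto
    have s: "{i. (f \<oplus>\<^bsub>?F\<^esub> g) i \<noteq> \<zero>\<^bsub>R\<^esub>} \<subseteq> ?A"
      by (auto simp: free_module_def)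
    have "h (f \<oplus>\<^bsub>?F\<^esub> g) = (\<Oplus>\<^bsub>P\<^esub>i\<in>?A. (f \<oplus>\<^bsub>?F\<^esub> g) i \<odot>\<^bsub>P\<^esub> p i)"
      by (rule h_eq[OF F.a_closed[OF f g] A s])
    also have "\<dots> = (\<Oplus>\<^bsub>P\<^esub>i\<in>?A. f i \<odot>\<^bsub>P\<^esub> p i \<oplus>\<^bsub>P\<^esub> g i \<odot>\<^bsub>P\<^esub> p i)"
    proof (rule P.add.finprod_cong')
      show "(\<lambda>i. f i \<odot>\<^bsub>P\<^esub> p i \<oplus>\<^bsub>P\<^esub> g i \<odot>\<^bsub>P\<^esub> p i) \<in> ?A \<rightarrow> carrier P" using r pA by blast
      show "(f \<oplus>\<^bsub>?F\<^esub> g) i \<odot>\<^bsub>P\<^esub> p i = f i \<odot>\<^bsub>P\<^esub> p i \<oplus>\<^bsub>P\<^esub> g i \<odot>\<^bsub>P\<^esub> p i" if "i \<in> ?A" for i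
        using P.smult_l_distr[OF r(1) r(2) pA[OF that]] by (simp add: free_module_def)
    qed simp
    also have "\<dots> = h f \<oplus>\<^bsub>P\<^esub> h g"
      using h_eq[OF f A] h_eq[OF g A] r pA
      by (subst P.finsum_addf) auto
    finally show "h (f \<oplus>\<^bsub>?F\<^esub> g) = h f \<oplus>\<^bsub>P\<^esub> h g" .
  next
    fix a f assume a: "a \<in> carrier R" and f: "f \<in> carrier ?F"
    interpret F: module R ?F by (rule module_free_module) (rule P.R.is_cring)
    let ?A = "{i. f i \<noteq> \<zero>\<^bsub>R\<^esub>}"
    have A: "finite ?A" "?A \<subseteq> I" using f by (auto simp: free_module_def)
    have r: "f i \<in> carrier R" for i using f by (auto simp: free_module_def)
    have pA: "i \<in> ?A \<Longrightarrow> p i \<in> carrier P" for i using A(2) p by auto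
    have s: "{i. (a \<odot>\<^bsub>?F\<^esub> f) i \<noteq> \<zero>\<^bsub>R\<^esub>} \<subseteq> ?A" using a
      by (auto simp: free_module_def)
    have "h (a \<odot>\<^bsub>?F\<^esub> f) = (\<Oplus>\<^bsub>P\<^esub>i\<in>?A. (a \<odot>\<^bsub>?F\<^esub> f) i \<odot>\<^bsub>P\<^esub> p i)"
      by (rule h_eq[OF F.smult_closed[OF a f] A s])
    also have "\<dots> = (\<Oplus>\<^bsub>P\<^esub>i\<in>?A. a \<odot>\<^bsub>P\<^esub> (f i \<odot>\<^bsub>P\<^esub> p i))"
    proof (rule P.add.finprod_cong')
      show "(\<lambda>i. a \<odot>\<^bsub>P\<^esub> (f i \<odot>\<^bsub>P\<^esub> p i)) \<in> ?A \<rightarrow> carrier P" using a r pA by blast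
      show "(a \<odot>\<^bsub>?F\<^esub> f) i \<odot>\<^bsub>P\<^esub> p i = a \<odot>\<^bsub>P\<^esub> (f i \<odot>\<^bsub>P\<^esub> p i)" if "i \<in> ?A" for i
        using P.smult_assoc1[OF a r pA[OF that]] by (simp add: free_module_def)
    qed simp
    also have "\<dots> = a \<odot>\<^bsub>P\<^esub> h f"
      unfolding h_def using a r pA A by (subst P.finsum_smult_ldistr) auto
    finally show "h (a \<odot>\<^bsub>?F\<^esub> f) = a \<odot>\<^bsub>P\<^esub> h f" .
  qed
  moreover have "h (free_gen R i) = p i" if i: "i \<in> I" for i
  proof -
    have "h (free_gen R i) = (\<Oplus>\<^bsub>P\<^esub>j\<in>{i}. free_gen R i j \<odot>\<^bsub>P\<^esub> p j)"
      by (rule h_eq[OF P.R.free_gen_closed[OF i]]) (auto simp: i free_gen_def)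
    then show ?thesis using p[OF i] by (simp add: free_gen_def)
  qed
  ultimately show ?thesis by blast
qed

context module
begin

lemma quotient_module_class_ops:
  assumes H: "submodule H R M"
  shows "carrier (quotient_module M H) = (\<lambda>x. H +>\<^bsub>M\<^esub> x) ` carrier M"
    and "\<zero>\<^bsub>quotient_module M H\<^esub> = H +>\<^bsub>M\<^esub> \<zero>\<^bsub>M\<^esub>"
    and "x \<in> carrier M \<Longrightarrow> y \<in> carrier M \<Longrightarrow>
      (H +>\<^bsub>M\<^esub> x) \<oplus>\<^bsub>quotient_module M H\<^esub> (H +>\<^bsub>M\<^esub> y) = H +>\<^bsub>M\<^esub> (x \<oplus>\<^bsub>M\<^esub> y)"
    and "a \<in> carrier R \<Longrightarrow> x \<in> carrier M \<Longrightarrow>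
      a \<odot>\<^bsub>quotient_module M H\<^esub> (H +>\<^bsub>M\<^esub> x) = H +>\<^bsub>M\<^esub> (a \<odot>\<^bsub>M\<^esub> x)"
    and "x \<in> carrier M \<Longrightarrow> y \<in> carrier M \<Longrightarrow>
      (H +>\<^bsub>M\<^esub> x = H +>\<^bsub>M\<^esub> y) = (x \<ominus>\<^bsub>M\<^esub> y \<in> H)"
proof -
  interpret H: abelian_subgroup H M
    using abelian_subgroupI3[of H M] submodule.axioms(1)[OF H]
    by (auto simp: additive_subgroup_def M.abelian_group_axioms)
  show "carrier (quotient_module M H) = (\<lambda>x. H +>\<^bsub>M\<^esub> x) ` carrier M"
    by (auto simp: quotient_module_def A_RCOSETS_def')
  show "\<zero>\<^bsub>quotient_module M H\<^esub> = H +>\<^bsub>M\<^esub> \<zero>\<^bsub>M\<^esub>"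
    by (simp add: quotient_module_def H.a_subset)
  show "(H +>\<^bsub>M\<^esub> x) \<oplus>\<^bsub>quotient_module M H\<^esub> (H +>\<^bsub>M\<^esub> y) = H +>\<^bsub>M\<^esub> (x \<oplus>\<^bsub>M\<^esub> y)"
    if "x \<in> carrier M" "y \<in> carrier M"
    using that by (simp add: quotient_module_def H.a_rcos_sum)
  show eq: "(H +>\<^bsub>M\<^esub> x = H +>\<^bsub>M\<^esub> y) = (x \<ominus>\<^bsub>M\<^esub> y \<in> H)"
    if "x \<in> carrier M" "y \<in> carrier M" for x y
    using that H.a_rcos_module[of y x] H.a_rcos_self[of x] H.a_repr_independence'[of x y]
    by (auto simp: a_minus_def)
  show "a \<odot>\<^bsub>quotient_module M H\<^esub> (H +>\<^bsub>M\<^esub> x) = H +>\<^bsub>M\<^esub> (a \<odot>\<^bsub>M\<^esub> x)"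
    if a: "a \<in> carrier R" and x: "x \<in> carrier M"
  proof -
    have "H +>\<^bsub>M\<^esub> (a \<odot>\<^bsub>M\<^esub> y) = H +>\<^bsub>M\<^esub> (a \<odot>\<^bsub>M\<^esub> x)" if "y \<in> H +>\<^bsub>M\<^esub> x" for y
    proof -
      have y: "y \<in> carrier M" using that x H.a_elemrcos_carrier by blast
      have "y \<ominus>\<^bsub>M\<^esub> x \<in> H" using that H.a_rcos_module[of x y] x y by (simp add: a_minus_def)
      then have "a \<odot>\<^bsub>M\<^esub> (y \<ominus>\<^bsub>M\<^esub> x) \<in> H" using submoduleE(4)[OF H a] by blast
      moreover have "a \<odot>\<^bsub>M\<^esub> (y \<ominus>\<^bsub>M\<^esub> x) = a \<odot>\<^bsub>M\<^esub> y \<ominus>\<^bsub>M\<^esub> a \<odot>\<^bsub>M\<^esub> x"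
        using a x y by (simp add: a_minus_def smult_r_distr smult_r_minus)
      ultimately show ?thesis by (simp only: eq[OF smult_closed[OF a y] smult_closed[OF a x]])
    qed
    then have "(\<Union>y\<in>H +>\<^bsub>M\<^esub> x. H +>\<^bsub>M\<^esub> (a \<odot>\<^bsub>M\<^esub> y)) = (\<Union>y\<in>H +>\<^bsub>M\<^esub> x. H +>\<^bsub>M\<^esub> (a \<odot>\<^bsub>M\<^esub> x))"
      by (rule SUP_cong[OF refl])
    moreover have "H +>\<^bsub>M\<^esub> x \<noteq> {}" using H.a_rcos_self[OF x] by blast
    ultimately show ?thesis by (simp add: quotient_module_def)
  qed
qed

lemma module_quotient_module:
  assumes H: "submodule H R M"
  shows "module R (quotient_module M H)"
proof -
  note q = quotient_module_class_ops[OF H]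
  show ?thesis
  proof (rule moduleI)
    show "abelian_group (quotient_module M H)"
    proof (rule abelian_groupI)
      fix X assume "X \<in> carrier (quotient_module M H)"
      then obtain x where x: "x \<in> carrier M" "X = H +>\<^bsub>M\<^esub> x" by (auto simp: q(1))
      then have "(H +>\<^bsub>M\<^esub> (\<ominus>\<^bsub>M\<^esub> x)) \<oplus>\<^bsub>quotient_module M H\<^esub> X = \<zero>\<^bsub>quotient_module M H\<^esub>"
        by (simp add: q M.l_neg)
      then show "\<exists>Y\<in>carrier (quotient_module M H). Y \<oplus>\<^bsub>quotient_module M H\<^esub> X = \<zero>\<^bsub>quotient_module M H\<^esub>"
        using x by (auto simp: q(1))
    qed (auto simp: q M.a_ac)
  qed (auto simp: q smult_l_distr smult_r_distr smult_assoc1 R.is_cring)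
qed

end

context
  fixes R :: "('r, 'x) ring_scheme" and M :: "('r, 'm, 'y) module_scheme" and N :: "('r, 'n, 'z) module_scheme"
  assumes M: "module R M" and N: "module R N"
begin

interpretation M: module R M by (rule M)
interpretation N: module R N by (rule N)

private abbreviation (input) "F \<equiv> free_module R (carrier M \<times> carrier N)"
private abbreviation (input) "e \<equiv> \<lambda>x y. free_gen R (x, y)"
private abbreviation (input) "K \<equiv> tensor_null R M N"
private abbreviation (input) "T \<equiv> M \<otimes>\<otimes>\<^bsub>R\<^esub> N"
private abbreviation (input) "t \<equiv> tensor_elem R M N"

interpretation F: module R F by (rule module_free_module) (rule M.R.is_cring)

private lemma e_closed: "x \<in> carrier M \<Longrightarrow> y \<in> carrier N \<Longrightarrow> e x y \<in> carrier F"
  by (rule M.R.free_gen_closed) simp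

private lemma relations_closed: "tensor_relations R M N \<subseteq> carrier F"
  unfolding tensor_relations_def Let_def
    by (intro Un_least; clarify) (simp_all add: e_closed)

private lemma submodule_K: "submodule K R F"
  unfolding tensor_null_def by (rule F.submodule_submodule_hull) (rule relations_closed)

private lemmas q = F.quotient_module_class_ops[OF submodule_K, folded tensor_prod_def]

lemma module_tensor_prod: "module R (M \<otimes>\<otimes>\<^bsub>R\<^esub> N)"
  unfolding tensor_prod_def by (rule F.module_quotient_module) (rule submodule_K)

lemma tensor_elem_bilinear: "tensor_elem R M N \<in> bilinear_maps R M N (M \<otimes>\<otimes>\<^bsub>R\<^esub> N)"
proof -
  have r: "K +>\<^bsub>F\<^esub> u = K +>\<^bsub>F\<^esub> v"
    if "u \<ominus>\<^bsub>F\<^esub> v \<in> tensor_relations R M N" "u \<in> carrier F" "v \<in> carrier F" for u v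
  proof -
    have "u \<ominus>\<^bsub>F\<^esub> v \<in> K"
      using that(1) unfolding tensor_null_def by (rule submodule_hull_superset[THEN subsetD])
    then show ?thesis by (simp only: q(5)[OF that(2,3)])
  qed
  have "t (x \<oplus>\<^bsub>M\<^esub> x') y = t x y \<oplus>\<^bsub>T\<^esub> t x' y"
    if "x \<in> carrier M" "x' \<in> carrier M" "y \<in> carrier N" for x x' y
  proof -
    have "K +>\<^bsub>F\<^esub> e (x \<oplus>\<^bsub>M\<^esub> x') y = K +>\<^bsub>F\<^esub> (e x y \<oplus>\<^bsub>F\<^esub> e x' y)"
      by (rule r) (use that in \<open>unfold tensor_relations_def Let_def, blast, simp_all add: e_closed\<close>)
    then show ?thesis using that by (simp add: tensor_elem_def q(3)[OF e_closed e_closed])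
  qed
  moreover have "t x (y \<oplus>\<^bsub>N\<^esub> y') = t x y \<oplus>\<^bsub>T\<^esub> t x y'"
    if "x \<in> carrier M" "y \<in> carrier N" "y' \<in> carrier N" for x y y'
  proof -
    have "K +>\<^bsub>F\<^esub> e x (y \<oplus>\<^bsub>N\<^esub> y') = K +>\<^bsub>F\<^esub> (e x y \<oplus>\<^bsub>F\<^esub> e x y')"
      by (rule r) (use that in \<open>unfold tensor_relations_def Let_def, blast, simp_all add: e_closed\<close>)
    then show ?thesis using that by (simp add: tensor_elem_def q(3)[OF e_closed e_closed])
  qed
  moreover have "t (a \<odot>\<^bsub>M\<^esub> x) y = a \<odot>\<^bsub>T\<^esub> t x y"
    if "a \<in> carrier R" "x \<in> carrier M" "y \<in> carrier N" for a x y
  proof -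
    have "K +>\<^bsub>F\<^esub> e (a \<odot>\<^bsub>M\<^esub> x) y = K +>\<^bsub>F\<^esub> (a \<odot>\<^bsub>F\<^esub> e x y)"
      by (rule r) (use that in \<open>unfold tensor_relations_def Let_def, blast, simp_all add: e_closed\<close>)
    then show ?thesis using that by (simp add: tensor_elem_def q(4)[OF _ e_closed])
  qed
  moreover have "t x (a \<odot>\<^bsub>N\<^esub> y) = a \<odot>\<^bsub>T\<^esub> t x y"
    if "a \<in> carrier R" "x \<in> carrier M" "y \<in> carrier N" for a x y
  proof -
    have "K +>\<^bsub>F\<^esub> e x (a \<odot>\<^bsub>N\<^esub> y) = K +>\<^bsub>F\<^esub> (a \<odot>\<^bsub>F\<^esub> e x y)"
      by (rule r) (use that in \<open>unfold tensor_relations_def Let_def, blast, simp_all add: e_closed\<close>)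
    then show ?thesis using that by (simp add: tensor_elem_def q(4)[OF _ e_closed])
  qed
  moreover have "t x y \<in> carrier T" if "x \<in> carrier M" "y \<in> carrier N" for x y
    using that e_closed by (auto simp: q(1) tensor_elem_def)
  ultimately show ?thesis by (auto simp: bilinear_maps_def linear_maps_def)
qed

lemma tensor_ext:
  assumes P: "module R P"
    and f: "f \<in> linear_maps R (M \<otimes>\<otimes>\<^bsub>R\<^esub> N) P" and g: "g \<in> linear_maps R (M \<otimes>\<otimes>\<^bsub>R\<^esub> N) P"
    and eq: "\<And>x y. x \<in> carrier M \<Longrightarrow> y \<in> carrier N \<Longrightarrow>
      f (tensor_elem R M N x y) = g (tensor_elem R M N x y)"
    and X: "X \<in> carrier (M \<otimes>\<otimes>\<^bsub>R\<^esub> N)"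
  shows "f X = g X"
proof -
  let ?c = "\<lambda>u. K +>\<^bsub>F\<^esub> u"
  have c: "h \<in> linear_maps R T P \<Longrightarrow> (\<lambda>u. h (?c u)) \<in> linear_maps R F P" for h
    unfolding linear_maps_def by (auto simp: q(1) q(3,4)[symmetric])
  obtain u where u: "u \<in> carrier F" "X = ?c u" using X q(1) by auto
  have "u \<in> {u \<in> carrier F. f (?c u) = g (?c u)}"
    by (rule M.R.free_module_induct[OF u(1) submodule_equalizer[OF F.module_axioms P c[OF f] c[OF g]]])
      (auto simp: e_closed eq[unfolded tensor_elem_def])
  then show ?thesis by (simp add: u)
qed

theorem tensor_universal:
  assumes P: "module R P" and b: "b \<in> bilinear_maps R M N P"
  shows "\<exists>!h. h \<in> linear_maps R (M \<otimes>\<otimes>\<^bsub>R\<^esub> N) P \<and> h \<in> extensional (carrier (M \<otimes>\<otimes>\<^bsub>R\<^esub> N)) \<and>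
    (\<forall>x\<in>carrier M. \<forall>y\<in>carrier N. h (tensor_elem R M N x y) = b x y)"
proof (rule ex_ex1I)
  interpret P: module R P by (rule P)
  let ?c = "\<lambda>u. K +>\<^bsub>F\<^esub> u"
  have bl: "x \<in> carrier M \<Longrightarrow> b x \<in> linear_maps R N P"
    and br: "y \<in> carrier N \<Longrightarrow> (\<lambda>x. b x y) \<in> linear_maps R M P" for x y
    using b by (auto simp: bilinear_maps_def)
  have bc: "x \<in> carrier M \<Longrightarrow> y \<in> carrier N \<Longrightarrow> b x y \<in> carrier P" for x y
    using linear_mapsD(1)[OF bl] .
  obtain h where h: "h \<in> linear_maps R F P"
    and he: "\<And>x y. x \<in> carrier M \<Longrightarrow> y \<in> carrier N \<Longrightarrow> h (e x y) = b x y"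
    using free_module_extend[OF P, of "carrier M \<times> carrier N" "\<lambda>(x, y). b x y"] bc by fastforce
  have z: "(\<lambda>_. \<zero>\<^bsub>P\<^esub>) \<in> linear_maps R F P" by (auto simp: linear_maps_def)
  have d: "h (u \<ominus>\<^bsub>F\<^esub> v) = \<zero>\<^bsub>P\<^esub>" if "u \<in> carrier F" "v \<in> carrier F" "h u = h v" for u v
    using that linear_mapsD(1)[OF h] linear_maps_zero_minus(3)[OF F.module_axioms P h]
    by (simp add: P.minus_eq_zero_iff)
  have "h u = \<zero>\<^bsub>P\<^esub>" if "u \<in> tensor_relations R M N" for u
    using that unfolding tensor_relations_def Let_def
    by (elim UnE CollectE exE conjE; hypsubst; intro d)
      (simp_all add: e_closed he linear_mapsD(2,3)[OF h] linear_mapsD(2,3)[OF bl]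
        linear_mapsD(2,3)[OF br])
  then have "tensor_relations R M N \<subseteq> {u \<in> carrier F. h u = \<zero>\<^bsub>P\<^esub>}"
    using relations_closed by blast
  then have K0: "u \<in> K \<Longrightarrow> h u = \<zero>\<^bsub>P\<^esub>" for u
    unfolding tensor_null_def
    using submodule_hull_least[OF submodule_equalizer[OF F.module_axioms P h z]] by blast
  have cong: "h u = h v" if u: "u \<in> carrier F" and v: "v \<in> carrier F" and uv: "?c u = ?c v" for u v
  proof -
    have "h u \<ominus>\<^bsub>P\<^esub> h v = \<zero>\<^bsub>P\<^esub>"
      using uv K0[of "u \<ominus>\<^bsub>F\<^esub> v"] q(5)[OF u v] linear_maps_zero_minus(3)[OF F.module_axioms P h u v]
      by simp
    then show ?thesis using linear_mapsD(1)[OF h] u v by (simp add: P.minus_eq_zero_iff)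
  qed
  define g where "g = restrict (\<lambda>X. h (SOME u. u \<in> carrier F \<and> X = ?c u)) (carrier T)"
  have gc: "g (?c u) = h u" if u: "u \<in> carrier F" for u
  proof -
    have "(SOME v. v \<in> carrier F \<and> ?c u = ?c v) \<in> carrier F \<and>
      ?c u = ?c (SOME v. v \<in> carrier F \<and> ?c u = ?c v)"
      by (rule someI[of _ u]) (use u in blast)
    then have "h (SOME v. v \<in> carrier F \<and> ?c u = ?c v) = h u"
      by (intro cong) (use u in auto)
    then show ?thesis using u by (simp add: g_def q(1))
  qed
  have "g \<in> linear_maps R T P"
    unfolding linear_maps_def by (auto simp: q gc linear_mapsD[OF h])
  moreover have "g \<in> extensional (carrier T)" by (simp add: g_def)
  moreover have "g (t x y) = b x y" if "x \<in> carrier M" "y \<in> carrier N" for x y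
    using that by (simp add: tensor_elem_def gc e_closed he)
  ultimately show "\<exists>h. h \<in> linear_maps R T P \<and> h \<in> extensional (carrier T) \<and>
    (\<forall>x\<in>carrier M. \<forall>y\<in>carrier N. h (t x y) = b x y)" by blast
next
  fix f g
  assume "f \<in> linear_maps R T P \<and> f \<in> extensional (carrier T) \<and>
      (\<forall>x\<in>carrier M. \<forall>y\<in>carrier N. f (t x y) = b x y)"
    "g \<in> linear_maps R T P \<and> g \<in> extensional (carrier T) \<and>
      (\<forall>x\<in>carrier M. \<forall>y\<in>carrier N. g (t x y) = b x y)"
  then show "f = g" by (intro extensionalityI[of f "carrier T" g]) (auto intro: tensor_ext[OF P])
qed

lemma tensor_lift:
  assumes "module R P" "b \<in> bilinear_maps R M N P"
  shows "tensor_lift R M N P b \<in> linear_maps R (M \<otimes>\<otimes>\<^bsub>R\<^esub> N) P"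
    and "x \<in> carrier M \<Longrightarrow> y \<in> carrier N \<Longrightarrow> tensor_lift R M N P b (tensor_elem R M N x y) = b x y"
  using theI'[OF tensor_universal[OF assms], folded tensor_lift_def] by auto

end

subsection \<open>The induced maps on pure tensors\<close>

lemma tensor_map_bilinear:
  assumes "module R M'" "module R N'" "f \<in> linear_maps R M M'" "g \<in> linear_maps R N N'"
  shows "(\<lambda>x y. tensor_elem R M' N' (f x) (g y)) \<in> bilinear_maps R M N (M' \<otimes>\<otimes>\<^bsub>R\<^esub> N')"
  using tensor_elem_bilinear[OF assms(1,2)] assms(3,4)
  by (auto simp: bilinear_maps_def linear_maps_def Pi_iff)

lemma tensor_map:
  assumes "module R M" "module R N" "module R M'" "module R N'"
    and "f \<in> linear_maps R M M'" "g \<in> linear_maps R N N'"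
  shows "tensor_map R M N M' N' f g \<in> linear_maps R (M \<otimes>\<otimes>\<^bsub>R\<^esub> N) (M' \<otimes>\<otimes>\<^bsub>R\<^esub> N')"
    and "x \<in> carrier M \<Longrightarrow> y \<in> carrier N \<Longrightarrow>
      tensor_map R M N M' N' f g (tensor_elem R M N x y) = tensor_elem R M' N' (f x) (g y)"
  unfolding tensor_map_def
  using tensor_lift[OF assms(1,2) module_tensor_prod[OF assms(3,4)] tensor_map_bilinear[OF assms(3-6)]]
  by simp_all

lemma tensor_swap:
  assumes "module R M" "module R N"
  shows "tensor_swap R M N \<in> linear_maps R (M \<otimes>\<otimes>\<^bsub>R\<^esub> N) (N \<otimes>\<otimes>\<^bsub>R\<^esub> M)"
    and "x \<in> carrier M \<Longrightarrow> y \<in> carrier N \<Longrightarrow>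
      tensor_swap R M N (tensor_elem R M N x y) = tensor_elem R N M y x"
proof -
  have "(\<lambda>x y. tensor_elem R N M y x) \<in> bilinear_maps R M N (N \<otimes>\<otimes>\<^bsub>R\<^esub> M)"
    using tensor_elem_bilinear[OF assms(2,1)] by (auto simp: bilinear_maps_def)
  note l = tensor_lift[OF assms module_tensor_prod[OF assms(2,1)] this, folded tensor_swap_def]
  show "tensor_swap R M N \<in> linear_maps R (M \<otimes>\<otimes>\<^bsub>R\<^esub> N) (N \<otimes>\<otimes>\<^bsub>R\<^esub> M)"
    and "x \<in> carrier M \<Longrightarrow> y \<in> carrier N \<Longrightarrow>
      tensor_swap R M N (tensor_elem R M N x y) = tensor_elem R N M y x"
    using l by simp_all
qed

text \<open>A trilinear map \<open>c\<close> induces a map that is linear in the first argument as well.\<close>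

lemma tensor_lift_linear:
  assumes L: "module R L" and M: "module R M" and N: "module R N" and P: "module R P"
    and c1: "\<And>x. x \<in> carrier L \<Longrightarrow> c x \<in> bilinear_maps R M N P"
    and c2: "\<And>y z. y \<in> carrier M \<Longrightarrow> z \<in> carrier N \<Longrightarrow> (\<lambda>x. c x y z) \<in> linear_maps R L P"
  shows "(\<lambda>x. tensor_lift R M N P (c x)) \<in> bilinear_maps R L (M \<otimes>\<otimes>\<^bsub>R\<^esub> N) P"
proof -
  interpret L: module R L by (rule L)
  interpret P: module R P by (rule P)
  let ?T = "M \<otimes>\<otimes>\<^bsub>R\<^esub> N"
  let ?h = "\<lambda>x. tensor_lift R M N P (c x)"
  have h: "x \<in> carrier L \<Longrightarrow> ?h x \<in> linear_maps R ?T P"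
    and he: "x \<in> carrier L \<Longrightarrow> y \<in> carrier M \<Longrightarrow> z \<in> carrier N \<Longrightarrow>
      ?h x (tensor_elem R M N y z) = c x y z" for x y z
    using tensor_lift[OF M N P c1] by auto
  have cc: "x \<in> carrier L \<Longrightarrow> y \<in> carrier M \<Longrightarrow> z \<in> carrier N \<Longrightarrow> c x y z \<in> carrier P" for x y z
    using linear_mapsD(1)[OF c2] .
  have "?h (x \<oplus>\<^bsub>L\<^esub> x') t = ?h x t \<oplus>\<^bsub>P\<^esub> ?h x' t"
    if x: "x \<in> carrier L" "x' \<in> carrier L" and t: "t \<in> carrier ?T" for x x' t
  proof (rule tensor_ext[OF M N P _ _ _ t])
    show "?h (x \<oplus>\<^bsub>L\<^esub> x') \<in> linear_maps R ?T P" using h x by simp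
    show "(\<lambda>t. ?h x t \<oplus>\<^bsub>P\<^esub> ?h x' t) \<in> linear_maps R ?T P"
      using h[OF x(1)] h[OF x(2)]
      by (auto simp: linear_maps_def Pi_iff P.smult_r_distr P.M.a_ac)
    show "?h (x \<oplus>\<^bsub>L\<^esub> x') (tensor_elem R M N y z) =
      ?h x (tensor_elem R M N y z) \<oplus>\<^bsub>P\<^esub> ?h x' (tensor_elem R M N y z)"
      if "y \<in> carrier M" "z \<in> carrier N" for y z
      using that x by (simp add: he linear_mapsD(2)[OF c2])
  qed
  moreover have "?h (a \<odot>\<^bsub>L\<^esub> x) t = a \<odot>\<^bsub>P\<^esub> ?h x t"
    if a: "a \<in> carrier R" and x: "x \<in> carrier L" and t: "t \<in> carrier ?T" for a x t
  proof (rule tensor_ext[OF M N P _ _ _ t])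
    show "?h (a \<odot>\<^bsub>L\<^esub> x) \<in> linear_maps R ?T P" using h x a by simp
    show "(\<lambda>t. a \<odot>\<^bsub>P\<^esub> ?h x t) \<in> linear_maps R ?T P"
      using h[OF x] a
      by (auto simp: linear_maps_def Pi_iff P.smult_r_distr L.R.m_comm simp flip: P.smult_assoc1)
    show "?h (a \<odot>\<^bsub>L\<^esub> x) (tensor_elem R M N y z) = a \<odot>\<^bsub>P\<^esub> ?h x (tensor_elem R M N y z)"
      if "y \<in> carrier M" "z \<in> carrier N" for y z
      using that x a by (simp add: he linear_mapsD(3)[OF c2])
  qed
  ultimately show ?thesis
    unfolding bilinear_maps_def using h linear_mapsD(1)[OF h]
    by (auto intro!: CollectI simp: linear_maps_def[of R L P])
qed

lemma tensor_elem3_linear: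
  assumes M: "module R M" and N: "module R N" and P: "module R P"
  shows "y \<in> carrier N \<Longrightarrow> z \<in> carrier P \<Longrightarrow>
      (\<lambda>x. tensor_elem3 R M N P x y z) \<in> linear_maps R M ((M \<otimes>\<otimes>\<^bsub>R\<^esub> N) \<otimes>\<otimes>\<^bsub>R\<^esub> P)"
    and "x \<in> carrier M \<Longrightarrow> z \<in> carrier P \<Longrightarrow>
      (\<lambda>y. tensor_elem3 R M N P x y z) \<in> linear_maps R N ((M \<otimes>\<otimes>\<^bsub>R\<^esub> N) \<otimes>\<otimes>\<^bsub>R\<^esub> P)"
    and "x \<in> carrier M \<Longrightarrow> y \<in> carrier N \<Longrightarrow>
      (\<lambda>z. tensor_elem3 R M N P x y z) \<in> linear_maps R P ((M \<otimes>\<otimes>\<^bsub>R\<^esub> N) \<otimes>\<otimes>\<^bsub>R\<^esub> P)"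
  using tensor_elem_bilinear[OF M N] tensor_elem_bilinear[OF module_tensor_prod[OF M N] P]
  by (auto simp: bilinear_maps_def linear_maps_def Pi_iff)

lemma tensor_assoc:
  assumes M: "module R M" and N: "module R N" and P: "module R P"
  shows "tensor_assoc R M N P \<in> linear_maps R (M \<otimes>\<otimes>\<^bsub>R\<^esub> (N \<otimes>\<otimes>\<^bsub>R\<^esub> P)) ((M \<otimes>\<otimes>\<^bsub>R\<^esub> N) \<otimes>\<otimes>\<^bsub>R\<^esub> P)"
    and "x \<in> carrier M \<Longrightarrow> y \<in> carrier N \<Longrightarrow> z \<in> carrier P \<Longrightarrow>
      tensor_assoc R M N P (tensor_elem R M (N \<otimes>\<otimes>\<^bsub>R\<^esub> P) x (tensor_elem R N P y z)) =
      tensor_elem3 R M N P x y z"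
proof -
  note e3 = tensor_elem3_linear[OF M N P]
  note T = module_tensor_prod[OF module_tensor_prod[OF M N] P]
  have b: "(\<lambda>y z. tensor_elem3 R M N P x y z) \<in> bilinear_maps R N P ((M \<otimes>\<otimes>\<^bsub>R\<^esub> N) \<otimes>\<otimes>\<^bsub>R\<^esub> P)"
    if "x \<in> carrier M" for x
    using e3(2,3) that by (auto simp: bilinear_maps_def)
  note l = tensor_lift[OF M module_tensor_prod[OF N P] T tensor_lift_linear[OF M N P T b e3(1)],
      folded tensor_assoc_def]
  show "tensor_assoc R M N P \<in> linear_maps R (M \<otimes>\<otimes>\<^bsub>R\<^esub> (N \<otimes>\<otimes>\<^bsub>R\<^esub> P)) ((M \<otimes>\<otimes>\<^bsub>R\<^esub> N) \<otimes>\<otimes>\<^bsub>R\<^esub> P)"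
    using l(1) by simp
  show "tensor_assoc R M N P (tensor_elem R M (N \<otimes>\<otimes>\<^bsub>R\<^esub> P) x (tensor_elem R N P y z)) =
      tensor_elem3 R M N P x y z" if x: "x \<in> carrier M" and y: "y \<in> carrier N" and z: "z \<in> carrier P"
  proof -
    have yz: "tensor_elem R N P y z \<in> carrier (N \<otimes>\<otimes>\<^bsub>R\<^esub> P)"
      using tensor_elem_bilinear[OF N P] y z by (auto simp: bilinear_maps_def linear_maps_def)
    show ?thesis using l(2)[OF _ _ _ x yz] tensor_lift(2)[OF N P T b[OF x] y z] by simp
  qed
qed

lemma tensor_cycle:
  assumes L: "module R L"
  shows "tensor_cycle R L \<in> linear_maps R ((L \<otimes>\<otimes>\<^bsub>R\<^esub> L) \<otimes>\<otimes>\<^bsub>R\<^esub> L) ((L \<otimes>\<otimes>\<^bsub>R\<^esub> L) \<otimes>\<otimes>\<^bsub>R\<^esub> L)"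
    and "x \<in> carrier L \<Longrightarrow> y \<in> carrier L \<Longrightarrow> z \<in> carrier L \<Longrightarrow>
      tensor_cycle R L (tensor_elem3 R L L L x y z) = tensor_elem3 R L L L y z x"
proof -
  note e3 = tensor_elem3_linear[OF L L L]
  note LL = module_tensor_prod[OF L L]
  note T = module_tensor_prod[OF LL L]
  have b: "(\<lambda>x y. tensor_elem3 R L L L y z x) \<in> bilinear_maps R L L ((L \<otimes>\<otimes>\<^bsub>R\<^esub> L) \<otimes>\<otimes>\<^bsub>R\<^esub> L)"
    if "z \<in> carrier L" for z
    using e3(1,3) that by (auto simp: bilinear_maps_def)
  have "(\<lambda>z t. tensor_lift R L L ((L \<otimes>\<otimes>\<^bsub>R\<^esub> L) \<otimes>\<otimes>\<^bsub>R\<^esub> L) (\<lambda>x y. tensor_elem3 R L L L y z x) t)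
    \<in> bilinear_maps R L (L \<otimes>\<otimes>\<^bsub>R\<^esub> L) ((L \<otimes>\<otimes>\<^bsub>R\<^esub> L) \<otimes>\<otimes>\<^bsub>R\<^esub> L)"
    using tensor_lift_linear[OF L L L T b e3(2)] by simp
  then have "(\<lambda>t z. tensor_lift R L L ((L \<otimes>\<otimes>\<^bsub>R\<^esub> L) \<otimes>\<otimes>\<^bsub>R\<^esub> L) (\<lambda>x y. tensor_elem3 R L L L y z x) t)
    \<in> bilinear_maps R (L \<otimes>\<otimes>\<^bsub>R\<^esub> L) L ((L \<otimes>\<otimes>\<^bsub>R\<^esub> L) \<otimes>\<otimes>\<^bsub>R\<^esub> L)"
    by (auto simp: bilinear_maps_def)
  note l = tensor_lift[OF LL L T this, folded tensor_cycle_def]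
  show "tensor_cycle R L \<in> linear_maps R ((L \<otimes>\<otimes>\<^bsub>R\<^esub> L) \<otimes>\<otimes>\<^bsub>R\<^esub> L) ((L \<otimes>\<otimes>\<^bsub>R\<^esub> L) \<otimes>\<otimes>\<^bsub>R\<^esub> L)"
    by (rule l(1))
  show "tensor_cycle R L (tensor_elem3 R L L L x y z) = tensor_elem3 R L L L y z x"
    if x: "x \<in> carrier L" and y: "y \<in> carrier L" and z: "z \<in> carrier L"
  proof -
    have xy: "tensor_elem R L L x y \<in> carrier (L \<otimes>\<otimes>\<^bsub>R\<^esub> L)"
      using tensor_elem_bilinear[OF L L] x y by (auto simp: bilinear_maps_def linear_maps_def)
    show ?thesis using l(2)[OF xy z] tensor_lift(2)[OF L L T b[OF z] x y] by simp
  qed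
qed

section \<open>Post-Hom-Lie coalgebras and their comodules\<close>

text \<open>
  \<open>D \<otimes> f\<close>, \<open>f \<otimes> D\<close> and \<open>\<tau> \<otimes> Id\<close> with values in \<open>(L \<otimes> L) \<otimes> M\<close>, where \<open>D\<close> maps to \<open>L \<otimes> L\<close> in
  the first case and to \<open>L \<otimes> M\<close> in the second one.
\<close>

definition comul_tensor ::
  "('r, 'x) ring_scheme \<Rightarrow> ('r, 'l, 'y) module_scheme \<Rightarrow> ('r, 'm, 'z) module_scheme \<Rightarrow>
    ('l \<Rightarrow> ('l \<times> 'l \<Rightarrow> 'r) set) \<Rightarrow> ('m \<Rightarrow> 'm) \<Rightarrow>
    ('l \<times> 'm \<Rightarrow> 'r) set \<Rightarrow> (('l \<times> 'l \<Rightarrow> 'r) set \<times> 'm \<Rightarrow> 'r) set"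
  where "comul_tensor R L M D f = tensor_map R L M (L \<otimes>\<otimes>\<^bsub>R\<^esub> L) M D f"

definition tensor_comul ::
  "('r, 'x) ring_scheme \<Rightarrow> ('r, 'l, 'y) module_scheme \<Rightarrow> ('r, 'm, 'z) module_scheme \<Rightarrow>
    ('l \<Rightarrow> 'l) \<Rightarrow> ('m \<Rightarrow> ('l \<times> 'm \<Rightarrow> 'r) set) \<Rightarrow>
    ('l \<times> 'm \<Rightarrow> 'r) set \<Rightarrow> (('l \<times> 'l \<Rightarrow> 'r) set \<times> 'm \<Rightarrow> 'r) set"
  where "tensor_comul R L M f D =
    tensor_assoc R L L M \<circ> tensor_map R L M L (L \<otimes>\<otimes>\<^bsub>R\<^esub> M) f D"

definition swap_tensor_id ::
  "('r, 'x) ring_scheme \<Rightarrow> ('r, 'l, 'y) module_scheme \<Rightarrow> ('r, 'm, 'z) module_scheme \<Rightarrow>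
    (('l \<times> 'l \<Rightarrow> 'r) set \<times> 'm \<Rightarrow> 'r) set \<Rightarrow> (('l \<times> 'l \<Rightarrow> 'r) set \<times> 'm \<Rightarrow> 'r) set"
  where "swap_tensor_id R L M =
    tensor_map R (L \<otimes>\<otimes>\<^bsub>R\<^esub> L) M (L \<otimes>\<otimes>\<^bsub>R\<^esub> L) M (tensor_swap R L L) id"

locale field_of_char_0 = field +
  assumes char_0: "\<And>n::nat. 0 < n \<Longrightarrow> [n] \<cdot> \<one> \<noteq> \<zero>"

text \<open>
  The parameter \<open>\<Delta>\<close> below is the map \<open>\<Delta>\<^sub>\<cdot>\<close>; in comodules, \<open>\<Delta>\<^sub>d\<close> and \<open>\<Delta>\<^sub>b\<close> are the maps
  \<open>\<Delta>\<^sub>\<diamond>\<close> and \<open>\<Delta>\<^sub>\<bullet>\<close>. The structure maps are only constrained on the carriers.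
\<close>

locale post_Hom_Lie_coalgebra = F?: field_of_char_0 R + L?: module R L
  for R :: "('r, 'x) ring_scheme" (structure) and L :: "('r, 'l, 'y) module_scheme" +
  fixes \<gamma> \<Delta> :: "'l \<Rightarrow> ('l \<times> 'l \<Rightarrow> 'r) set" and \<alpha> :: "'l \<Rightarrow> 'l"
  assumes \<gamma>_linear: "\<gamma> \<in> linear_maps R L (L \<otimes>\<otimes> L)"
    and \<Delta>_linear: "\<Delta> \<in> linear_maps R L (L \<otimes>\<otimes> L)"
    and \<alpha>_linear: "\<alpha> \<in> linear_maps R L L"
    and \<gamma>_skew: "x \<in> carrier L \<Longrightarrow> \<gamma> x = \<ominus>\<^bsub>L \<otimes>\<otimes> L\<^esub> tensor_swap R L L (\<gamma> x)"
    and \<gamma>_\<alpha>: "x \<in> carrier L \<Longrightarrow> \<gamma> (\<alpha> x) = tensor_map R L L L L \<alpha> \<alpha> (\<gamma> x)"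
    and co_Jacobi: "x \<in> carrier L \<Longrightarrow>
      (let t = tensor_comul R L L \<alpha> \<gamma> (\<gamma> x) in
        t \<oplus>\<^bsub>(L \<otimes>\<otimes> L) \<otimes>\<otimes> L\<^esub> tensor_cycle R L t
          \<oplus>\<^bsub>(L \<otimes>\<otimes> L) \<otimes>\<otimes> L\<^esub> tensor_cycle R L (tensor_cycle R L t))
      = \<zero>\<^bsub>(L \<otimes>\<otimes> L) \<otimes>\<otimes> L\<^esub>"
    and \<gamma>_\<Delta>_compat: "x \<in> carrier L \<Longrightarrow>
      tensor_comul R L L \<alpha> \<gamma> (\<Delta> x)
        \<ominus>\<^bsub>(L \<otimes>\<otimes> L) \<otimes>\<otimes> L\<^esub> comul_tensor R L L \<Delta> \<alpha> (\<gamma> x)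
        \<ominus>\<^bsub>(L \<otimes>\<otimes> L) \<otimes>\<otimes> L\<^esub> swap_tensor_id R L L (tensor_comul R L L \<alpha> \<Delta> (\<gamma> x))
      = \<zero>\<^bsub>(L \<otimes>\<otimes> L) \<otimes>\<otimes> L\<^esub>"
    and \<Delta>_associator: "x \<in> carrier L \<Longrightarrow>
      comul_tensor R L L \<Delta> \<alpha> (\<Delta> x)
        \<ominus>\<^bsub>(L \<otimes>\<otimes> L) \<otimes>\<otimes> L\<^esub> tensor_comul R L L \<alpha> \<Delta> (\<Delta> x)
        \<ominus>\<^bsub>(L \<otimes>\<otimes> L) \<otimes>\<otimes> L\<^esub> swap_tensor_id R L L (comul_tensor R L L \<Delta> \<alpha> (\<Delta> x))
        \<oplus>\<^bsub>(L \<otimes>\<otimes> L) \<otimes>\<otimes> L\<^esub> swap_tensor_id R L L (tensor_comul R L L \<alpha> \<Delta> (\<Delta> x))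
        \<oplus>\<^bsub>(L \<otimes>\<otimes> L) \<otimes>\<otimes> L\<^esub> comul_tensor R L L \<gamma> \<alpha> (\<Delta> x)
      = \<zero>\<^bsub>(L \<otimes>\<otimes> L) \<otimes>\<otimes> L\<^esub>"

locale comultiplicative_post_Hom_Lie_coalgebra = post_Hom_Lie_coalgebra +
  assumes \<Delta>_\<alpha>: "x \<in> carrier L \<Longrightarrow> \<Delta> (\<alpha> x) = tensor_map R L L L L \<alpha> \<alpha> (\<Delta> x)"

locale post_Hom_Lie_comodule = post_Hom_Lie_coalgebra R L \<gamma> \<Delta> \<alpha> + M?: module R M
  for R :: "('r, 'x) ring_scheme" (structure) and L :: "('r, 'l, 'y) module_scheme"
    and \<gamma> \<Delta> :: "'l \<Rightarrow> ('l \<times> 'l \<Rightarrow> 'r) set" and \<alpha> :: "'l \<Rightarrow> 'l"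
    and M :: "('r, 'm, 'z) module_scheme" +
  fixes \<Delta>\<^sub>d \<Delta>\<^sub>b :: "'m \<Rightarrow> ('l \<times> 'm \<Rightarrow> 'r) set" and \<alpha>\<^sub>M :: "'m \<Rightarrow> 'm"
  assumes \<Delta>\<^sub>d_linear: "\<Delta>\<^sub>d \<in> linear_maps R M (L \<otimes>\<otimes> M)"
    and \<Delta>\<^sub>b_linear: "\<Delta>\<^sub>b \<in> linear_maps R M (L \<otimes>\<otimes> M)"
    and \<alpha>\<^sub>M_linear: "\<alpha>\<^sub>M \<in> linear_maps R M M"
    and \<Delta>\<^sub>d_\<alpha>\<^sub>M: "m \<in> carrier M \<Longrightarrow> \<Delta>\<^sub>d (\<alpha>\<^sub>M m) = tensor_map R L M L M \<alpha> \<alpha>\<^sub>M (\<Delta>\<^sub>d m)"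
    and \<Delta>\<^sub>b_\<alpha>\<^sub>M: "m \<in> carrier M \<Longrightarrow> \<Delta>\<^sub>b (\<alpha>\<^sub>M m) = tensor_map R L M L M \<alpha> \<alpha>\<^sub>M (\<Delta>\<^sub>b m)"
    and \<gamma>_\<Delta>\<^sub>d: "m \<in> carrier M \<Longrightarrow>
      comul_tensor R L M \<gamma> \<alpha>\<^sub>M (\<Delta>\<^sub>d m) =
        tensor_comul R L M \<alpha> \<Delta>\<^sub>d (\<Delta>\<^sub>d m)
          \<ominus>\<^bsub>(L \<otimes>\<otimes> L) \<otimes>\<otimes> M\<^esub> swap_tensor_id R L M (tensor_comul R L M \<alpha> \<Delta>\<^sub>d (\<Delta>\<^sub>d m))"
    and \<Delta>_\<Delta>\<^sub>d: "m \<in> carrier M \<Longrightarrow>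
      comul_tensor R L M \<Delta> \<alpha>\<^sub>M (\<Delta>\<^sub>d m) =
        tensor_comul R L M \<alpha> \<Delta>\<^sub>d (\<Delta>\<^sub>b m)
          \<ominus>\<^bsub>(L \<otimes>\<otimes> L) \<otimes>\<otimes> M\<^esub> swap_tensor_id R L M (tensor_comul R L M \<alpha> \<Delta>\<^sub>b (\<Delta>\<^sub>d m))"
    and \<gamma>_\<Delta>\<^sub>b: "m \<in> carrier M \<Longrightarrow>
      comul_tensor R L M \<gamma> \<alpha>\<^sub>M (\<Delta>\<^sub>b m) =
        (tensor_comul R L M \<alpha> \<Delta>\<^sub>b (\<Delta>\<^sub>b m)
          \<ominus>\<^bsub>(L \<otimes>\<otimes> L) \<otimes>\<otimes> M\<^esub> swap_tensor_id R L M (tensor_comul R L M \<alpha> \<Delta>\<^sub>b (\<Delta>\<^sub>b m)))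
        \<oplus>\<^bsub>(L \<otimes>\<otimes> L) \<otimes>\<otimes> M\<^esub>
        (swap_tensor_id R L M (comul_tensor R L M \<Delta> \<alpha>\<^sub>M (\<Delta>\<^sub>b m))
          \<ominus>\<^bsub>(L \<otimes>\<otimes> L) \<otimes>\<otimes> M\<^esub> comul_tensor R L M \<Delta> \<alpha>\<^sub>M (\<Delta>\<^sub>b m))"

end

(* Put A = \<alpha>^k. Following the structure maps by A \<otimes> I multiplies both sides of each
   comodule axiom by the same map (A \<otimes> A) \<otimes> I, because \<alpha> commutes with the comultiplications
   and \<tau> \<otimes> I commutes with (A \<otimes> A) \<otimes> I. So it suffices to treat k = 0, where two of the identities are
   rearrangements of axioms of L. The remaining one, (\<gamma> \<otimes> \<alpha>)\<gamma> = (1 - \<tau> \<otimes> I) t for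
   t = (\<alpha> \<otimes> \<gamma>)\<gamma>, is the co-Jacobi identity t + \<xi> t + \<xi>^2 t = 0, since skewness
   gives (\<gamma> \<otimes> \<alpha>)\<gamma> = - \<xi> t and (\<tau> \<otimes> I) t = - \<xi>^2 t. *)

theory Submission
  imports Defs
begin

section \<open>Linear maps on tensor products\<close>

lemma linear_maps_comp:
  assumes "g \<in> linear_maps R N P" "f \<in> linear_maps R M N"
  shows "g \<circ> f \<in> linear_maps R M P" and "(\<lambda>x. g (f x)) \<in> linear_maps R M P"
  using assms by (auto simp: linear_maps_def Pi_iff)

lemma linear_maps_id: "id \<in> linear_maps R M M"
  by (auto simp: linear_maps_def)

lemma linear_maps_funpow: "f \<in> linear_maps R M M \<Longrightarrow> f ^^ n \<in> linear_maps R M M"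
proof (induction n)
  case 0
  show ?case using linear_maps_id by (simp add: id_def)
next
  case (Suc n)
  then show ?case using linear_maps_comp(1)[of f R M M "f ^^ n" M] by (simp only: funpow.simps(2))
qed

lemma linear_maps_uminus:
  assumes M: "module R M" and N: "module R N" and f: "f \<in> linear_maps R M N"
  shows "(\<lambda>x. \<ominus>\<^bsub>N\<^esub> f x) \<in> linear_maps R M N"
proof -
  interpret N: module R N by (rule N)
  show ?thesis
    using f by (auto simp: linear_maps_def Pi_iff N.smult_r_minus N.M.minus_add)
qed

section \<open>Pure tensors, and linear maps determined by their values on them\<close>

lemma tensor_elem_closed:
  assumes "module R M" "module R N" "x \<in> carrier M" "y \<in> carrier N"
  shows "tensor_elem R M N x y \<in> carrier (M \<otimes>\<otimes>\<^bsub>R\<^esub> N)"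
  using tensor_elem_bilinear[OF assms(1,2)] assms(3,4)
  by (auto simp: bilinear_maps_def linear_maps_def)

lemma tensor_elem_linear:
  assumes "module R M" "module R N"
  shows "x \<in> carrier M \<Longrightarrow> tensor_elem R M N x \<in> linear_maps R N (M \<otimes>\<otimes>\<^bsub>R\<^esub> N)"
    and "y \<in> carrier N \<Longrightarrow> (\<lambda>x. tensor_elem R M N x y) \<in> linear_maps R M (M \<otimes>\<otimes>\<^bsub>R\<^esub> N)"
  using tensor_elem_bilinear[OF assms] by (auto simp: bilinear_maps_def)

text \<open>With the last factor \<open>z\<close> fixed, both sides are linear in \<open>t\<close>
  in \<open>M \<otimes> N\<close>, so \<open>tensor_ext\<close> can be used a second time.
  Identities between maps on triple tensors then need checking only on pure ones.\<close>

lemma tensor_ext3: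
  assumes M: "module R M" and N: "module R N" and P: "module R P" and Q: "module R Q"
    and f: "f \<in> linear_maps R ((M \<otimes>\<otimes>\<^bsub>R\<^esub> N) \<otimes>\<otimes>\<^bsub>R\<^esub> P) Q"
    and g: "g \<in> linear_maps R ((M \<otimes>\<otimes>\<^bsub>R\<^esub> N) \<otimes>\<otimes>\<^bsub>R\<^esub> P) Q"
    and eq: "\<And>x y z. x \<in> carrier M \<Longrightarrow> y \<in> carrier N \<Longrightarrow> z \<in> carrier P \<Longrightarrow>
      f (tensor_elem3 R M N P x y z) = g (tensor_elem3 R M N P x y z)"
    and X: "X \<in> carrier ((M \<otimes>\<otimes>\<^bsub>R\<^esub> N) \<otimes>\<otimes>\<^bsub>R\<^esub> P)"
  shows "f X = g X"
proof (rule tensor_ext[OF module_tensor_prod[OF M N] P Q f g _ X])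
  fix t z assume t: "t \<in> carrier (M \<otimes>\<otimes>\<^bsub>R\<^esub> N)" and z: "z \<in> carrier P"
  note e = tensor_elem_linear(2)[OF module_tensor_prod[OF M N] P z]
  show "f (tensor_elem R (M \<otimes>\<otimes>\<^bsub>R\<^esub> N) P t z) = g (tensor_elem R (M \<otimes>\<otimes>\<^bsub>R\<^esub> N) P t z)"
    by (rule tensor_ext[OF M N Q linear_maps_comp(2)[OF f e] linear_maps_comp(2)[OF g e] _ t])
      (rule eq[OF _ _ z])
qed

text \<open>The right-bracketed counterpart, suited to the domain of \<open>tensor_assoc\<close>;
  here the first factor is the one held fixed.\<close>

lemma tensor_ext3':
  assumes M: "module R M" and N: "module R N" and P: "module R P" and Q: "module R Q"
    and f: "f \<in> linear_maps R (M \<otimes>\<otimes>\<^bsub>R\<^esub> (N \<otimes>\<otimes>\<^bsub>R\<^esub> P)) Q"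
    and g: "g \<in> linear_maps R (M \<otimes>\<otimes>\<^bsub>R\<^esub> (N \<otimes>\<otimes>\<^bsub>R\<^esub> P)) Q"
    and eq: "\<And>x y z. x \<in> carrier M \<Longrightarrow> y \<in> carrier N \<Longrightarrow> z \<in> carrier P \<Longrightarrow>
      f (tensor_elem R M (N \<otimes>\<otimes>\<^bsub>R\<^esub> P) x (tensor_elem R N P y z)) =
      g (tensor_elem R M (N \<otimes>\<otimes>\<^bsub>R\<^esub> P) x (tensor_elem R N P y z))"
    and X: "X \<in> carrier (M \<otimes>\<otimes>\<^bsub>R\<^esub> (N \<otimes>\<otimes>\<^bsub>R\<^esub> P))"
  shows "f X = g X"
proof (rule tensor_ext[OF M module_tensor_prod[OF N P] Q f g _ X])
  fix x t assume x: "x \<in> carrier M" and t: "t \<in> carrier (N \<otimes>\<otimes>\<^bsub>R\<^esub> P)"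
  note e = tensor_elem_linear(1)[OF M module_tensor_prod[OF N P] x]
  show "f (tensor_elem R M (N \<otimes>\<otimes>\<^bsub>R\<^esub> P) x t) = g (tensor_elem R M (N \<otimes>\<otimes>\<^bsub>R\<^esub> P) x t)"
    by (rule tensor_ext[OF N P Q linear_maps_comp(2)[OF f e] linear_maps_comp(2)[OF g e] _ t])
      (rule eq[OF x])
qed

section \<open>Functoriality of \<open>f \<otimes> g\<close> and naturality of the
  associator\<close>

lemma tensor_map_comp:
  assumes M: "module R M" "module R M'" "module R M''"
    and N: "module R N" "module R N'" "module R N''"
    and f: "f \<in> linear_maps R M M'" "f' \<in> linear_maps R M' M''"
    and g: "g \<in> linear_maps R N N'" "g' \<in> linear_maps R N' N''"
    and X: "X \<in> carrier (M \<otimes>\<otimes>\<^bsub>R\<^esub> N)"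
  shows "tensor_map R M' N' M'' N'' f' g' (tensor_map R M N M' N' f g X) =
    tensor_map R M N M'' N'' (f' \<circ> f) (g' \<circ> g) X"
proof -
  note m = tensor_map[OF M(1) N(1) M(2) N(2) f(1) g(1)]
  note m' = tensor_map[OF M(2) N(2) M(3) N(3) f(2) g(2)]
  note m'' = tensor_map[OF M(1) N(1) M(3) N(3) linear_maps_comp(1)[OF f(2,1)]
      linear_maps_comp(1)[OF g(2,1)]]
  show ?thesis
    by (rule tensor_ext[OF M(1) N(1) module_tensor_prod[OF M(3) N(3)]
          linear_maps_comp(2)[OF m'(1) m(1)] m''(1) _ X])
      (simp add: m(2) m'(2) m''(2) linear_mapsD(1)[OF f(1)] linear_mapsD(1)[OF g(1)])
qed

text \<open>Structure maps are constrained only on carriers, so \<open>\<alpha>\<close> and an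
  endomorphism may commute there without their composites being equal as HOL functions. Agreement on
  carriers suffices because pure tensors determine the induced map.\<close>

lemma tensor_map_cong:
  assumes M: "module R M" "module R M'" and N: "module R N" "module R N'"
    and f: "f \<in> linear_maps R M M'" "f' \<in> linear_maps R M M'"
    and g: "g \<in> linear_maps R N N'" "g' \<in> linear_maps R N N'"
    and eq: "\<And>x. x \<in> carrier M \<Longrightarrow> f x = f' x" "\<And>y. y \<in> carrier N \<Longrightarrow> g y = g' y"
    and X: "X \<in> carrier (M \<otimes>\<otimes>\<^bsub>R\<^esub> N)"
  shows "tensor_map R M N M' N' f g X = tensor_map R M N M' N' f' g' X"
proof -
  note m = tensor_map[OF M(1) N(1) M(2) N(2) f(1) g(1)]
  note m' = tensor_map[OF M(1) N(1) M(2) N(2) f(2) g(2)]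
  show ?thesis
    by (rule tensor_ext[OF M(1) N(1) module_tensor_prod[OF M(2) N(2)] m(1) m'(1) _ X])
      (simp add: m(2) m'(2) eq)
qed

text \<open>Both sides send \<open>x \<otimes> (y \<otimes> z)\<close> to
  \<open>(f x \<otimes> g y) \<otimes> h z\<close>.\<close>

lemma tensor_assoc_natural:
  assumes M: "module R M" "module R M'" and N: "module R N" "module R N'"
    and P: "module R P" "module R P'"
    and f: "f \<in> linear_maps R M M'" and g: "g \<in> linear_maps R N N'" and h: "h \<in> linear_maps R P P'"
    and X: "X \<in> carrier (M \<otimes>\<otimes>\<^bsub>R\<^esub> (N \<otimes>\<otimes>\<^bsub>R\<^esub> P))"
  shows "tensor_assoc R M' N' P'
      (tensor_map R M (N \<otimes>\<otimes>\<^bsub>R\<^esub> P) M' (N' \<otimes>\<otimes>\<^bsub>R\<^esub> P') f (tensor_map R N P N' P' g h) X) =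
    tensor_map R (M \<otimes>\<otimes>\<^bsub>R\<^esub> N) P (M' \<otimes>\<otimes>\<^bsub>R\<^esub> N') P' (tensor_map R M N M' N' f g) h
      (tensor_assoc R M N P X)"
proof -
  note gh = tensor_map[OF N(1) P(1) N(2) P(2) g h]
  note fg = tensor_map[OF M(1) N(1) M(2) N(2) f g]
  note r = tensor_map[OF M(1) module_tensor_prod[OF N(1) P(1)] M(2)
      module_tensor_prod[OF N(2) P(2)] f gh(1)]
  note l = tensor_map[OF module_tensor_prod[OF M(1) N(1)] P(1)
      module_tensor_prod[OF M(2) N(2)] P(2) fg(1) h]
  note a = tensor_assoc[OF M(1) N(1) P(1)]
  note a' = tensor_assoc[OF M(2) N(2) P(2)]
  note T = module_tensor_prod[OF module_tensor_prod[OF M(2) N(2)] P(2)]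
  show ?thesis
    by (rule tensor_ext3'[OF M(1) N(1) P(1) T linear_maps_comp(2)[OF a'(1) r(1)]
          linear_maps_comp(2)[OF l(1) a(1)] _ X])
      (simp add: r(2) l(2) gh(2) fg(2) a(2) a'(2) tensor_elem_closed M N P linear_mapsD(1)[OF f]
        linear_mapsD(1)[OF g] linear_mapsD(1)[OF h])
qed

section \<open>Twisting by an endomorphism\<close>

context
  fixes R :: "('r, 'x) ring_scheme" and L :: "('r, 'l, 'y) module_scheme"
  assumes L: "module R L"
begin

private lemmas LL = module_tensor_prod[OF L L]
private lemmas LLL = module_tensor_prod[OF LL L]
private lemmas S = tensor_swap[OF L L]
private lemmas SI = tensor_map[OF LL L LL L S(1) linear_maps_id]

section \<open>The exchange of the first two factors of a triple tensor\<close>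

lemma swap_tensor_id_linear:
  "swap_tensor_id R L L \<in> linear_maps R ((L \<otimes>\<otimes>\<^bsub>R\<^esub> L) \<otimes>\<otimes>\<^bsub>R\<^esub> L) ((L \<otimes>\<otimes>\<^bsub>R\<^esub> L) \<otimes>\<otimes>\<^bsub>R\<^esub> L)"
  unfolding swap_tensor_id_def by (rule SI(1))

lemma swap_tensor_id_elem:
  "x \<in> carrier L \<Longrightarrow> y \<in> carrier L \<Longrightarrow> z \<in> carrier L \<Longrightarrow>
    swap_tensor_id R L L (tensor_elem3 R L L L x y z) = tensor_elem3 R L L L y x z"
  by (simp add: swap_tensor_id_def SI(2) S(2) tensor_elem_closed L)

text \<open>The two exchanged factors are acted on by the same map \<open>A\<close>, so it does not
  matter whether \<open>A\<close> acts before or after the exchange.\<close>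

lemma swap_tensor_id_twist:
  assumes A: "A \<in> linear_maps R L L" and X: "X \<in> carrier ((L \<otimes>\<otimes>\<^bsub>R\<^esub> L) \<otimes>\<otimes>\<^bsub>R\<^esub> L)"
  defines "Q \<equiv> tensor_map R (L \<otimes>\<otimes>\<^bsub>R\<^esub> L) L (L \<otimes>\<otimes>\<^bsub>R\<^esub> L) L (tensor_map R L L L L A A) id"
  shows "swap_tensor_id R L L (Q X) = Q (swap_tensor_id R L L X)"
proof -
  note AA = tensor_map[OF L L L L A A]
  note Q = tensor_map[OF LL L LL L AA(1) linear_maps_id, folded Q_def]
  show ?thesis
    by (rule tensor_ext3[OF L L L LLL linear_maps_comp(2)[OF swap_tensor_id_linear Q(1)]
          linear_maps_comp(2)[OF Q(1) swap_tensor_id_linear] _ X])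
      (simp add: swap_tensor_id_elem Q(2) AA(2) tensor_elem_closed L linear_mapsD(1)[OF A])
qed

section \<open>Comultiplying one leg by a map \<open>D\<close>, later taken to be
  \<open>\<gamma>\<close> or \<open>\<Delta>\<close>\<close>

context
  fixes \<alpha> :: "'l \<Rightarrow> 'l" and D :: "'l \<Rightarrow> ('l \<times> 'l \<Rightarrow> 'r) set"
  assumes \<alpha>: "\<alpha> \<in> linear_maps R L L" and D: "D \<in> linear_maps R L (L \<otimes>\<otimes>\<^bsub>R\<^esub> L)"
begin

private lemmas D\<alpha> = tensor_map[OF L L LL L D \<alpha>]
private lemmas \<alpha>D = tensor_map[OF L L L LL \<alpha> D]

lemma comul_tensor_linear: "comul_tensor R L L D \<alpha> \<in> linear_maps R (L \<otimes>\<otimes>\<^bsub>R\<^esub> L) ((L \<otimes>\<otimes>\<^bsub>R\<^esub> L) \<otimes>\<otimes>\<^bsub>R\<^esub> L)"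
  unfolding comul_tensor_def by (rule D\<alpha>(1))

lemma tensor_comul_linear: "tensor_comul R L L \<alpha> D \<in> linear_maps R (L \<otimes>\<otimes>\<^bsub>R\<^esub> L) ((L \<otimes>\<otimes>\<^bsub>R\<^esub> L) \<otimes>\<otimes>\<^bsub>R\<^esub> L)"
  unfolding tensor_comul_def by (rule linear_maps_comp(1)[OF tensor_assoc(1)[OF L L L] \<alpha>D(1)])

text \<open>On \<open>x \<otimes> y\<close> both sides are \<open>D y \<otimes> \<alpha> x\<close>:
  the cyclic map carries the first factor of \<open>\<alpha> x \<otimes> D y\<close> to the
  end.\<close>

lemma comul_tensor_swap:
  assumes X: "X \<in> carrier (L \<otimes>\<otimes>\<^bsub>R\<^esub> L)"
  shows "comul_tensor R L L D \<alpha> (tensor_swap R L L X) = tensor_cycle R L (tensor_comul R L L \<alpha> D X)"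
proof -
  note C = tensor_cycle[OF L]
  note a = tensor_assoc[OF L L L]
  show ?thesis
  proof (rule tensor_ext[OF L L LLL linear_maps_comp(2)[OF comul_tensor_linear S(1)]
        linear_maps_comp(2)[OF C(1) tensor_comul_linear] _ X])
    fix x y assume x: "x \<in> carrier L" and y: "y \<in> carrier L"
    have \<alpha>x: "\<alpha> x \<in> carrier L" using linear_mapsD(1)[OF \<alpha> x] .
    \<comment> \<open>\<open>D y\<close> need not be a pure tensor, so the identity is proved for an
      arbitrary \<open>t\<close> in its place, where linearity in \<open>t\<close> reduces it to
      pure tensors.\<close>
    have "tensor_elem R (L \<otimes>\<otimes>\<^bsub>R\<^esub> L) L t (\<alpha> x) =
        tensor_cycle R L (tensor_assoc R L L L (tensor_elem R L (L \<otimes>\<otimes>\<^bsub>R\<^esub> L) (\<alpha> x) t))"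
      if t: "t \<in> carrier (L \<otimes>\<otimes>\<^bsub>R\<^esub> L)" for t
      by (rule tensor_ext[OF L L LLL tensor_elem_linear(2)[OF LL L \<alpha>x] linear_maps_comp(2)[OF C(1)
            linear_maps_comp(2)[OF a(1) tensor_elem_linear(1)[OF L LL \<alpha>x]]] _ t])
        (simp add: a(2) C(2) \<alpha>x)
    from this[OF linear_mapsD(1)[OF D y]]
    show "comul_tensor R L L D \<alpha> (tensor_swap R L L (tensor_elem R L L x y)) =
        tensor_cycle R L (tensor_comul R L L \<alpha> D (tensor_elem R L L x y))"
      using x y by (simp add: S(2) D\<alpha>(2) \<alpha>D(2) comul_tensor_def tensor_comul_def)
  qed
qed

text \<open>Exchanging the last two factors and then the first two is \<open>\<xi>^2\<close>: x y z
  becomes x z y and then z x y. Skewness of \<open>D\<close> provides the first exchange at the cost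
  of a sign.\<close>

lemma swap_tensor_id_skew:
  assumes skew: "\<And>x. x \<in> carrier L \<Longrightarrow> D x = \<ominus>\<^bsub>L \<otimes>\<otimes>\<^bsub>R\<^esub> L\<^esub> tensor_swap R L L (D x)"
    and X: "X \<in> carrier (L \<otimes>\<otimes>\<^bsub>R\<^esub> L)"
  shows "swap_tensor_id R L L (tensor_comul R L L \<alpha> D X) =
    \<ominus>\<^bsub>(L \<otimes>\<otimes>\<^bsub>R\<^esub> L) \<otimes>\<otimes>\<^bsub>R\<^esub> L\<^esub> tensor_cycle R L (tensor_cycle R L (tensor_comul R L L \<alpha> D X))"
proof -
  note C = tensor_cycle[OF L]
  note a = tensor_assoc[OF L L L]
  note CC = linear_maps_comp(2)[OF C(1) C(1)]
  note W = swap_tensor_id_linear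
  show ?thesis
  proof (rule tensor_ext[OF L L LLL linear_maps_comp(2)[OF W tensor_comul_linear]
        linear_maps_uminus[OF LL LLL linear_maps_comp(2)[OF CC tensor_comul_linear]] _ X])
    fix x y assume x: "x \<in> carrier L" and y: "y \<in> carrier L"
    have \<alpha>x: "\<alpha> x \<in> carrier L" using linear_mapsD(1)[OF \<alpha> x] .
    let ?e = "\<lambda>t. tensor_assoc R L L L (tensor_elem R L (L \<otimes>\<otimes>\<^bsub>R\<^esub> L) (\<alpha> x) t)"
    have e: "?e \<in> linear_maps R (L \<otimes>\<otimes>\<^bsub>R\<^esub> L) ((L \<otimes>\<otimes>\<^bsub>R\<^esub> L) \<otimes>\<otimes>\<^bsub>R\<^esub> L)"
      by (rule linear_maps_comp(2)[OF a(1) tensor_elem_linear(1)[OF L LL \<alpha>x]])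
    note We = linear_maps_comp(2)[OF W e]
    \<comment> \<open>The permutation identity without the sign, again for arbitrary
      \<open>t\<close> so that it can be applied to \<open>D y\<close>.\<close>
    have es: "swap_tensor_id R L L (?e (tensor_swap R L L t)) =
        tensor_cycle R L (tensor_cycle R L (?e t))"
      if t: "t \<in> carrier (L \<otimes>\<otimes>\<^bsub>R\<^esub> L)" for t
      by (rule tensor_ext[OF L L LLL linear_maps_comp(2)[OF We S(1)] linear_maps_comp(2)[OF CC e] _ t])
        (simp add: a(2) S(2) C(2) swap_tensor_id_elem \<alpha>x)
    have Dy: "D y \<in> carrier (L \<otimes>\<otimes>\<^bsub>R\<^esub> L)" using linear_mapsD(1)[OF D y] .
    have "swap_tensor_id R L L (?e (D y)) =
        swap_tensor_id R L L (?e (\<ominus>\<^bsub>L \<otimes>\<otimes>\<^bsub>R\<^esub> L\<^esub> tensor_swap R L L (D y)))"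
      using skew[OF y] by simp
    also have "\<dots> = \<ominus>\<^bsub>(L \<otimes>\<otimes>\<^bsub>R\<^esub> L) \<otimes>\<otimes>\<^bsub>R\<^esub> L\<^esub> tensor_cycle R L (tensor_cycle R L (?e (D y)))"
      using linear_maps_zero_minus(2)[OF LL LLL We linear_mapsD(1)[OF S(1) Dy]] es[OF Dy] by simp
    finally show "swap_tensor_id R L L (tensor_comul R L L \<alpha> D (tensor_elem R L L x y)) =
        \<ominus>\<^bsub>(L \<otimes>\<otimes>\<^bsub>R\<^esub> L) \<otimes>\<otimes>\<^bsub>R\<^esub> L\<^esub> tensor_cycle R L
          (tensor_cycle R L (tensor_comul R L L \<alpha> D (tensor_elem R L L x y)))"
      using x y by (simp add: \<alpha>D(2) tensor_comul_def)
  qed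
qed

section \<open>Moving a twist of the legs out of the comultiplied expressions\<close>

context
  fixes A :: "'l \<Rightarrow> 'l"
  assumes A: "A \<in> linear_maps R L L"
begin

private abbreviation (input) "AI \<equiv> tensor_map R L L L L A id"
private abbreviation (input) "AAI \<equiv> tensor_map R (L \<otimes>\<otimes>\<^bsub>R\<^esub> L) L (L \<otimes>\<otimes>\<^bsub>R\<^esub> L) L (tensor_map R L L L L A A) id"

private lemmas AI = tensor_map[OF L L L L A linear_maps_id]
private lemmas AA = tensor_map[OF L L L L A A]
private lemmas AAI = tensor_map[OF LL L LL L AA(1) linear_maps_id]

text \<open>The twist sits on the leg that \<open>D\<close> splits, and \<open>D\<close> turns
  \<open>A\<close> into \<open>A \<otimes> A\<close>.\<close>

lemma comul_tensor_twist:
  assumes DA: "\<And>x. x \<in> carrier L \<Longrightarrow> D (A x) = tensor_map R L L L L A A (D x)"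
    and X: "X \<in> carrier (L \<otimes>\<otimes>\<^bsub>R\<^esub> L)"
  shows "comul_tensor R L L D \<alpha> (AI X) = AAI (comul_tensor R L L D \<alpha> X)"
  unfolding comul_tensor_def
  by (rule tensor_ext[OF L L LLL linear_maps_comp(2)[OF D\<alpha>(1) AI(1)]
        linear_maps_comp(2)[OF AAI(1) D\<alpha>(1)] _ X])
    (simp add: AI(2) D\<alpha>(2) AAI(2) DA linear_mapsD(1)[OF A] linear_mapsD(1)[OF D] linear_mapsD(1)[OF \<alpha>])

text \<open>The outer twist passes \<open>\<alpha>\<close> and lands on the first factor; the inner
  one, following \<open>D\<close>, lands on the second. Together they give
  \<open>A \<otimes> (A \<otimes> I)\<close>, which naturality of the associator rebrackets as
  \<open>(A \<otimes> A) \<otimes> I\<close>.\<close>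

lemma tensor_comul_twist:
  assumes \<alpha>A: "\<And>x. x \<in> carrier L \<Longrightarrow> \<alpha> (A x) = A (\<alpha> x)"
    and X: "X \<in> carrier (L \<otimes>\<otimes>\<^bsub>R\<^esub> L)"
  shows "tensor_comul R L L \<alpha> (AI \<circ> D) (AI X) = AAI (tensor_comul R L L \<alpha> D X)"
proof -
  let ?AD = "tensor_map R L L L (L \<otimes>\<otimes>\<^bsub>R\<^esub> L)"
  note m = linear_maps_comp(1)[OF AI(1) D]
  \<comment> \<open>The factor \<open>id\<close> comes from the second leg of \<open>AI\<close>; it
    is kept so that \<open>tensor_map_comp\<close> matches literally.\<close>
  have "?AD \<alpha> (AI \<circ> D) (AI X) = ?AD (\<alpha> \<circ> A) ((AI \<circ> D) \<circ> id) X"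
    by (rule tensor_map_comp[OF L L L L L LL A \<alpha> linear_maps_id m X])
  also have "\<dots> = ?AD (A \<circ> \<alpha>) (AI \<circ> D) X"
    by (rule tensor_map_cong[OF L L L LL linear_maps_comp(1)[OF \<alpha> A] linear_maps_comp(1)[OF A \<alpha>]])
      (simp_all add: m \<alpha>A X)
  also have "\<dots> = tensor_map R L (L \<otimes>\<otimes>\<^bsub>R\<^esub> L) L (L \<otimes>\<otimes>\<^bsub>R\<^esub> L) A AI (?AD \<alpha> D X)"
    by (rule tensor_map_comp[OF L L L L LL LL \<alpha> A D AI(1) X, symmetric])
  finally show ?thesis
    using tensor_assoc_natural[OF L L L L L L A A linear_maps_id linear_mapsD(1)[OF \<alpha>D(1) X]]
    by (simp add: tensor_comul_def)
qed

end

end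

end

section \<open>The regular comodule and its twists\<close>

text \<open>Turns \<open>\<gamma>_\<Delta>_compat\<close> into the shape of a comodule axiom, with
  its middle term isolated.\<close>

lemma (in abelian_group) minus_minus_eq_zero_iff:
  assumes "a \<in> carrier G" "b \<in> carrier G" "c \<in> carrier G"
  shows "a \<ominus> b \<ominus> c = \<zero> \<longleftrightarrow> b = a \<ominus> c"
proof -
  have "a \<ominus> b \<ominus> c = (a \<ominus> c) \<ominus> b" using assms by (simp add: a_minus_def a_ac)
  then show ?thesis using assms minus_eq_zero_iff[of "a \<ominus> c" b] by auto
qed

section \<open>The co-Jacobi identity as a comodule identity\<close>

context post_Hom_Lie_coalgebra
begin

text \<open>This is the untwisted case of the comodule axiom
  \<open>\<gamma>_\<Delta>\<^sub>d\<close>.\<close>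

lemma co_Jacobi_skew:
  assumes x: "x \<in> carrier L"
  shows "comul_tensor R L L \<gamma> \<alpha> (\<gamma> x) =
    tensor_comul R L L \<alpha> \<gamma> (\<gamma> x)
      \<ominus>\<^bsub>(L \<otimes>\<otimes> L) \<otimes>\<otimes> L\<^esub> swap_tensor_id R L L (tensor_comul R L L \<alpha> \<gamma> (\<gamma> x))"
proof -
  note L = L.module_axioms
  note LL = module_tensor_prod[OF L L]
  note LLL = module_tensor_prod[OF LL L]
  interpret T: module R "(L \<otimes>\<otimes> L) \<otimes>\<otimes> L" by (rule LLL)
  let ?T = "(L \<otimes>\<otimes> L) \<otimes>\<otimes> L"
  let ?c = "tensor_cycle R L"
  define t where "t = tensor_comul R L L \<alpha> \<gamma> (\<gamma> x)"
  have \<gamma>x: "\<gamma> x \<in> carrier (L \<otimes>\<otimes> L)" using linear_mapsD(1)[OF \<gamma>_linear x] .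
  have t: "t \<in> carrier ?T"
    unfolding t_def by (rule linear_mapsD(1)[OF tensor_comul_linear[OF L \<alpha>_linear \<gamma>_linear] \<gamma>x])
  have ct: "?c t \<in> carrier ?T" "?c (?c t) \<in> carrier ?T"
    using linear_mapsD(1)[OF tensor_cycle(1)[OF L]] t by auto
  have "comul_tensor R L L \<gamma> \<alpha> (\<gamma> x) = comul_tensor R L L \<gamma> \<alpha> (\<ominus>\<^bsub>L \<otimes>\<otimes> L\<^esub> tensor_swap R L L (\<gamma> x))"
    using \<gamma>_skew[OF x] by simp
  also have "\<dots> = \<ominus>\<^bsub>?T\<^esub> ?c t"
    using linear_maps_zero_minus(2)[OF LL LLL comul_tensor_linear[OF L \<alpha>_linear \<gamma>_linear]
        linear_mapsD(1)[OF tensor_swap(1)[OF L L] \<gamma>x]]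
      comul_tensor_swap[OF L \<alpha>_linear \<gamma>_linear \<gamma>x]
    by (simp add: t_def)
  \<comment> \<open>To identify the negative of \<open>?c t\<close>, an element is needed whose sum
    with it is zero; co-Jacobi supplies it.\<close>
  also have "\<dots> = t \<oplus>\<^bsub>?T\<^esub> ?c (?c t)"
  proof (rule T.M.minus_equality)
    show "t \<oplus>\<^bsub>?T\<^esub> ?c (?c t) \<oplus>\<^bsub>?T\<^esub> ?c t = \<zero>\<^bsub>?T\<^esub>"
      using co_Jacobi[OF x] t ct by (simp add: t_def[symmetric] Let_def T.M.a_ac)
  qed (use t ct in auto)
  also have "\<dots> = t \<ominus>\<^bsub>?T\<^esub> swap_tensor_id R L L t"
    using swap_tensor_id_skew[OF L \<alpha>_linear \<gamma>_linear \<gamma>_skew \<gamma>x] ct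
    by (simp add: a_minus_def t_def[symmetric])
  finally show ?thesis unfolding t_def .
qed

end

section \<open>The twisted comodule for every exponent \<open>k\<close>\<close>

theorem proposition5p5:
  fixes R :: "('r, 'x) ring_scheme" and L :: "('r, 'l, 'y) module_scheme"
    and \<gamma> \<Delta> :: "'l \<Rightarrow> ('l \<times> 'l \<Rightarrow> 'r) set" and \<alpha> :: "'l \<Rightarrow> 'l" and k :: nat
  assumes "comultiplicative_post_Hom_Lie_coalgebra R L \<gamma> \<Delta> \<alpha>"
  shows "post_Hom_Lie_comodule R L \<gamma> \<Delta> \<alpha> L
    (tensor_map R L L L L (\<alpha> ^^ k) id \<circ> \<gamma>)
    (tensor_map R L L L L (\<alpha> ^^ k) id \<circ> \<Delta>)
    \<alpha>"
proof -
  interpret comultiplicative_post_Hom_Lie_coalgebra R L \<gamma> \<Delta> \<alpha> by (rule assms)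
  note L = L.module_axioms
  note LL = module_tensor_prod[OF L L]
  note LLL = module_tensor_prod[OF LL L]
  let ?T = "(L \<otimes>\<otimes>\<^bsub>R\<^esub> L) \<otimes>\<otimes>\<^bsub>R\<^esub> L"
  interpret T: module R ?T by (rule LLL)
  let ?A = "\<alpha> ^^ k"
  let ?AI = "tensor_map R L L L L ?A id"
  let ?AA = "tensor_map R L L L L ?A ?A"
  let ?AAI = "tensor_map R (L \<otimes>\<otimes>\<^bsub>R\<^esub> L) L (L \<otimes>\<otimes>\<^bsub>R\<^esub> L) L ?AA id"
  let ?\<alpha>\<alpha> = "tensor_map R L L L L \<alpha> \<alpha>"
  let ?S = "swap_tensor_id R L L"
  have A: "\<alpha> ^^ n \<in> linear_maps R L L" for n by (rule linear_maps_funpow[OF \<alpha>_linear])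
  have \<alpha>A: "\<alpha> (?A x) = ?A (\<alpha> x)" for x by (rule funpow_swap1)
  note AI = tensor_map[OF L L L L A linear_maps_id]
  note \<alpha>\<alpha> = tensor_map[OF L L L L \<alpha>_linear \<alpha>_linear]
  note AAI = tensor_map[OF LL L LL L tensor_map(1)[OF L L L L A A] linear_maps_id]
  \<comment> \<open>Supplies the commutation hypothesis of \<open>comul_tensor_twist\<close> for
    \<open>\<gamma>\<close> and \<open>\<Delta>\<close> alike.\<close>
  have comul_pow: "D ((\<alpha> ^^ n) x) = tensor_map R L L L L (\<alpha> ^^ n) (\<alpha> ^^ n) (D x)"
    if D: "D \<in> linear_maps R L (L \<otimes>\<otimes>\<^bsub>R\<^esub> L)"
      and D\<alpha>: "\<And>x. x \<in> carrier L \<Longrightarrow> D (\<alpha> x) = ?\<alpha>\<alpha> (D x)"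
      and x: "x \<in> carrier L" for D n x
  proof (induction n)
    case 0
    note i = tensor_map[OF L L L L linear_maps_id linear_maps_id]
    \<comment> \<open>\<open>tensor_map\<close> is a definite description, so
      \<open>id \<otimes> id\<close> does not unfold to \<open>id\<close>; the two are compared on
      pure tensors.\<close>
    have "tensor_map R L L L L id id (D x) = id (D x)"
      by (rule tensor_ext[OF L L LL i(1) linear_maps_id _ linear_mapsD(1)[OF D x]]) (simp add: i(2))
    then show ?case by (simp add: id_def)
  next
    case (Suc n)
    have "D ((\<alpha> ^^ Suc n) x) = ?\<alpha>\<alpha> (tensor_map R L L L L (\<alpha> ^^ n) (\<alpha> ^^ n) (D x))"
      using D\<alpha>[OF linear_mapsD(1)[OF A x]] Suc by simp
    also have "\<dots> = tensor_map R L L L L (\<alpha> \<circ> \<alpha> ^^ n) (\<alpha> \<circ> \<alpha> ^^ n) (D x)"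
      by (rule tensor_map_comp[OF L L L L L L A \<alpha>_linear A \<alpha>_linear linear_mapsD(1)[OF D x]])
    finally show ?case by (simp only: funpow.simps(2))
  qed
  \<comment> \<open>Transfers \<open>\<gamma>_\<alpha>\<close> and \<open>\<Delta>_\<alpha>\<close>
    to the twisted maps; it holds because \<open>\<alpha>\<close> commutes with its powers.\<close>
  have twist_\<alpha>: "?AI (?\<alpha>\<alpha> X) = ?\<alpha>\<alpha> (?AI X)" if X: "X \<in> carrier (L \<otimes>\<otimes>\<^bsub>R\<^esub> L)" for X
    by (rule tensor_ext[OF L L LL linear_maps_comp(2)[OF AI(1) \<alpha>\<alpha>(1)]
          linear_maps_comp(2)[OF \<alpha>\<alpha>(1) AI(1)] _ X])
      (simp add: AI(2) \<alpha>\<alpha>(2) linear_mapsD(1)[OF A] linear_mapsD(1)[OF \<alpha>_linear] \<alpha>A)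
  note g = linear_mapsD(1)[OF \<gamma>_linear] and d = linear_mapsD(1)[OF \<Delta>_linear]
  note cg = comul_tensor_twist[OF L \<alpha>_linear \<gamma>_linear A comul_pow[OF \<gamma>_linear \<gamma>_\<alpha>]]
  note cd = comul_tensor_twist[OF L \<alpha>_linear \<Delta>_linear A comul_pow[OF \<Delta>_linear \<Delta>_\<alpha>]]
  note tg = tensor_comul_twist[OF L \<alpha>_linear \<gamma>_linear A \<alpha>A]
  note td = tensor_comul_twist[OF L \<alpha>_linear \<Delta>_linear A \<alpha>A]
  note S = swap_tensor_id_twist[OF L A]
  note c_cg = linear_mapsD(1)[OF comul_tensor_linear[OF L \<alpha>_linear \<gamma>_linear]]
  note c_cd = linear_mapsD(1)[OF comul_tensor_linear[OF L \<alpha>_linear \<Delta>_linear]]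
  note c_tg = linear_mapsD(1)[OF tensor_comul_linear[OF L \<alpha>_linear \<gamma>_linear]]
  note c_td = linear_mapsD(1)[OF tensor_comul_linear[OF L \<alpha>_linear \<Delta>_linear]]
  note c_S = linear_mapsD(1)[OF swap_tensor_id_linear[OF L]]
  note AAI_add = linear_mapsD(2)[OF AAI(1)] and AAI_minus = linear_maps_zero_minus(3)[OF LLL LLL AAI(1)]
  \<comment> \<open>\<open>S\<close> moves \<open>?AAI\<close> outward past the exchange; the other
    rules discharge membership conditions.\<close>
  note simps = S g d c_cg c_cd c_tg c_td c_S
  show ?thesis
  \<comment> \<open>Goals 1 to 3 are linearity, 4 and 5 compatibility with \<open>\<alpha>\<close>,
    and 6 to 8 the axioms \<open>\<gamma>_\<Delta>\<^sub>d\<close>,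
    \<open>\<Delta>_\<Delta>\<^sub>d\<close> and \<open>\<gamma>_\<Delta>\<^sub>b\<close>.\<close>
  proof (unfold_locales, goal_cases)
    case 1 show ?case by (rule linear_maps_comp(1)[OF AI(1) \<gamma>_linear])
  next
    case 2 show ?case by (rule linear_maps_comp(1)[OF AI(1) \<Delta>_linear])
  next
    case 3 show ?case by (rule \<alpha>_linear)
  next
    case (4 m) then show ?case by (simp add: \<gamma>_\<alpha> twist_\<alpha> g)
  next
    case (5 m) then show ?case by (simp add: \<Delta>_\<alpha> twist_\<alpha> d)
  next
    case (6 m)
    \<comment> \<open>The untwisted identity is pushed through the linear map \<open>?AAI\<close>;
      the goal has the same form once \<open>cg\<close>, \<open>tg\<close> and \<open>S\<close> have
      collected its twists into \<open>?AAI\<close>.\<close>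
    have "?AAI (comul_tensor R L L \<gamma> \<alpha> (\<gamma> m)) = ?AAI (tensor_comul R L L \<alpha> \<gamma> (\<gamma> m))
        \<ominus>\<^bsub>?T\<^esub> ?AAI (?S (tensor_comul R L L \<alpha> \<gamma> (\<gamma> m)))"
      using 6 by (simp only: co_Jacobi_skew AAI_minus simps)
    then show ?case using 6 by (simp only: o_apply cg tg simps)
  next
    case (7 m)
    have "comul_tensor R L L \<Delta> \<alpha> (\<gamma> m) =
        tensor_comul R L L \<alpha> \<gamma> (\<Delta> m) \<ominus>\<^bsub>?T\<^esub> ?S (tensor_comul R L L \<alpha> \<Delta> (\<gamma> m))"
      using \<gamma>_\<Delta>_compat[OF 7] 7 T.M.minus_minus_eq_zero_iff by (simp only: simps)
    then have "?AAI (comul_tensor R L L \<Delta> \<alpha> (\<gamma> m)) = ?AAI (tensor_comul R L L \<alpha> \<gamma> (\<Delta> m))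
        \<ominus>\<^bsub>?T\<^esub> ?AAI (?S (tensor_comul R L L \<alpha> \<Delta> (\<gamma> m)))"
      using 7 by (simp only: AAI_minus simps)
    then show ?case using 7 by (simp only: o_apply cd tg td simps)
  next
    case (8 m)
    let ?a = "comul_tensor R L L \<Delta> \<alpha> (\<Delta> m)" and ?b = "tensor_comul R L L \<alpha> \<Delta> (\<Delta> m)"
      and ?c = "comul_tensor R L L \<gamma> \<alpha> (\<Delta> m)"
    have mem: "?a \<in> carrier ?T" "?b \<in> carrier ?T" "?c \<in> carrier ?T"
      "?S ?a \<in> carrier ?T" "?S ?b \<in> carrier ?T"
      using 8 by (simp_all only: simps)
    \<comment> \<open>\<open>\<Delta>_associator\<close> is solved for its last summand
      \<open>?c\<close>, the negative of the other four terms; distributing the sign then gives the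
      right-hand side of \<open>\<gamma>_\<Delta>\<^sub>b\<close>.\<close>
    have "\<ominus>\<^bsub>?T\<^esub> (?a \<ominus>\<^bsub>?T\<^esub> ?b \<ominus>\<^bsub>?T\<^esub> ?S ?a \<oplus>\<^bsub>?T\<^esub> ?S ?b) = ?c"
      using \<Delta>_associator[OF 8] mem
      by (intro T.M.minus_equality) (simp_all add: T.M.a_comm)
    then have "?c = (?b \<ominus>\<^bsub>?T\<^esub> ?S ?b) \<oplus>\<^bsub>?T\<^esub> (?S ?a \<ominus>\<^bsub>?T\<^esub> ?a)"
      using mem by (simp add: a_minus_def T.M.minus_add T.M.a_ac)
    then have "?AAI ?c = (?AAI ?b \<ominus>\<^bsub>?T\<^esub> ?AAI (?S ?b)) \<oplus>\<^bsub>?T\<^esub> (?AAI (?S ?a) \<ominus>\<^bsub>?T\<^esub> ?AAI ?a)"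
      using mem by (simp only: AAI_minus AAI_add T.M.minus_closed)
    then show ?case using 8 by (simp only: o_apply cg cd td simps)
  qed
qed

end
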